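(* Let $\mu$ be an order-invariant measure on $(\Omega,\mathcal{F})$. The following are equivalent: (i) $\mu$ is extremal; (ii) $\mu$ has trivial tails; (iii) $\mu$ is essential.
   Context: Notation: $\mathbb{N}=\{1,2,\dots\}$, $[k]=\{1,\dots,k\}$. Partial orders are strict. A suborder of $\mathbb{N}$ (or of $[k]$) is a partial order $<^{\mathbb{N}}$ on $\mathbb{N}$ (or $<^{[k]}$ on $[k]$) such that if $i$ is below $j$ in it then $i<j$ in the standard order. For a suborder $<^{\mathbb N}$, $<^{\mathbb N}_{[k]}$ denotes its restriction to $[k]$. The space: $\Omega$ is the set of pairs $\omega=(x_1x_2\cdots,<^{\mathbb{N}})$, where $x_1x_2\cdots$ is an infinite sequence of elements of $[0,1]$ and $<^{\mathbb{N}}$ is a suborder of $\mathbb{N}$. For Borel sets $B_1,\dots,B_k\subseteq[0,1]$ and a suborder $<^{[k]}$ of $[k]$, the basic event $E(B_1\cdots B_k,<^{[k]})$ is the set of $\omega=(x_1x_2\cdots,<^{\mathbb{N}})\in\Omega$ with $x_i\in B_i$ for $i=1,\dots,k$ and $<^{\mathbb{N}}_{[k]}$ equal to $<^{[k]}$. $\mathcal{F}$ is the $\sigma$-field on $\Omega$ generated by all basic events. Order-invariance: a linear extension of a suborder $<^{[k]}$ is a permutation $\lambda$ of $[k]$ such that $\lambda(i)<^{[k]}\lambda(j)$ implies $i<j$; $\lambda[<^{[k]}]$ is the suborder of $[k]$ in which $i$ is below $j$ if and only if $\lambda(i)<^{[k]}\lambda(j)$. A probability measure $\mu$ on $(\Omega,\mathcal{F})$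 is order-invariant if $\mu(E(B_1\cdots B_k,<^{[k]}))=\mu(E(B_{\lambda(1)}\cdots B_{\lambda(k)},\lambda[<^{[k]}]))$ for all $k$, all Borel sets $B_1,\dots,B_k\subseteq[0,1]$, all suborders $<^{[k]}$ of $[k]$ and all linear extensions $\lambda$ of $<^{[k]}$. It is extremal if it cannot be written as $r\mu_1+(1-r)\mu_2$ with $r\in(0,1)$ and $\mu_1\neq\mu_2$ order-invariant measures. The measures $\nu^k$: for $\omega=(x_1x_2\cdots,<^{\mathbb N})$, $k\in\mathbb N$ and $\lambda$ a linear extension of $<^{\mathbb N}_{[k]}$, let $\lambda^+$ be the permutation of $\mathbb N$ equal to $\lambda$ on $[k]$ and fixing all $i>k$, and let $\lambda^+[\omega]=(x_{\lambda^+(1)}x_{\lambda^+(2)}\cdots,\lambda^+[<^{\mathbb N}])$, where $i$ is below $j$ in $\lambda^+[<^{\mathbb N}]$ iff $\lambda^+(i)<^{\mathbb N}\lambda^+(j)$. For $E\in\mathcal F$, $\nu^k(E)(\omega)$ is the proportion of linear extensions $\lambda$ of $<^{\mathbb N}_{[k]}$ such that $\lambda^+[\omega]\in E$. An order-invariant measure $\mu$ is essential if, for every $E\in\mathcal F$, $\nu^k(E)(\omega)\to\mu(E)$ as $k\to\infty$ for $\mu$-almost every $\omega$. Tail events: for $i\in\mathbb N$ let $\lambda^{(i)}$ be the permutation of $\mathbb N$ exchanging $i$ and $i+1$; for $\omega=(x_1x_2\cdots,<^{\mathbb N})$ let $\lambda^{(i)}[\omega]=(x_{\lambda^{(i)}(1)}x_{\lambda^{(i)}(2)}\cdots,\lambda^{(i)}[<^{\mathbb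 N}])$ if $i,i+1$ are incomparable in $<^{\mathbb N}$, and $\lambda^{(i)}[\omega]=\omega$ if $i<^{\mathbb N}i+1$. Let $\mathcal G_k=\{H\in\mathcal F:\omega\in H\Rightarrow\lambda^{(i)}[\omega]\in H\text{ for all }i<k\}$, and let $\mathcal G=\bigcap_{k}\mathcal G_k$ be the tail $\sigma$-field. $\mu$ has trivial tails if $\mu(H)\in\{0,1\}$ for every $H\in\mathcal G$. *)

theory Defs
  imports "HOL-Probability.Probability" "HOL-Combinatorics.Permutations"
begin

text \<open>
  The paper's natural numbers start at 1, so positions are the elements of \<open>{1..}\<close> and
  \<open>[k]\<close> is \<open>{1..k}\<close>. A relation is a set of pairs; \<open>(i, j) \<in> R\<close> means that \<open>i\<close> is below \<open>j\<close>.
\<close>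

definition suborder :: "nat set \<Rightarrow> (nat \<times> nat) set \<Rightarrow> bool" where
  "suborder A R \<longleftrightarrow> R \<subseteq> A \<times> A \<and> irrefl R \<and> trans R \<and> (\<forall>i j. (i, j) \<in> R \<longrightarrow> i < j)"

type_synonym outcome = "(nat \<Rightarrow> real) \<times> (nat \<times> nat) set"

text \<open>Sequences are extensional functions on \<open>{1..}\<close>: the value at 0 is fixed and carries no data.\<close>

definition Omega :: "outcome set" where
  "Omega = ({1..} \<rightarrow>\<^sub>E {0..1}) \<times> {R. suborder {1..} R}"

definition basic_event :: "nat \<Rightarrow> (nat \<Rightarrow> real set) \<Rightarrow> (nat \<times> nat) set \<Rightarrow> outcome set" where
  "basic_event k B r =
     {(x, R) \<in> Omega. (\<forall>i\<in>{1..k}. x i \<in> B i) \<and> R \<inter> ({1..k} \<times> {1..k}) = r}"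

definition borel_family :: "nat \<Rightarrow> (nat \<Rightarrow> real set) \<Rightarrow> bool" where
  "borel_family k B \<longleftrightarrow> (\<forall>i\<in>{1..k}. B i \<in> sets borel \<and> B i \<subseteq> {0..1})"

definition basic_events :: "outcome set set" where
  "basic_events = {basic_event k B r | k B r. 1 \<le> k \<and> borel_family k B \<and> suborder {1..k} r}"

definition event_field :: "outcome set set" where
  "event_field = sigma_sets Omega basic_events"

text \<open>
  By definition of \<open>permutes\<close>, a permutation of \<open>[k]\<close> is a function on all of \<open>nat\<close> that fixes every
  point outside \<open>[k]\<close>, so a linear extension \<open>l\<close> already coincides with its prolongation \<open>l\<^sup>+\<close>.
\<close>

definition linear_extension :: "nat \<Rightarrow> (nat \<times> nat) set \<Rightarrow> (nat \<Rightarrow> nat) \<Rightarrow> bool" where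
  "linear_extension k r l \<longleftrightarrow>
     l permutes {1..k} \<and> (\<forall>i\<in>{1..k}. \<forall>j\<in>{1..k}. (l i, l j) \<in> r \<longrightarrow> i < j)"

definition perm_order :: "(nat \<Rightarrow> nat) \<Rightarrow> (nat \<times> nat) set \<Rightarrow> (nat \<times> nat) set" where
  "perm_order l r = {(i, j). (l i, l j) \<in> r}"

definition perm_outcome :: "(nat \<Rightarrow> nat) \<Rightarrow> outcome \<Rightarrow> outcome" where
  "perm_outcome l \<omega> = (\<lambda>i. fst \<omega> (l i), perm_order l (snd \<omega>))"

definition order_invariant :: "outcome measure \<Rightarrow> bool" where
  "order_invariant \<mu> \<longleftrightarrow>
     prob_space \<mu> \<and> space \<mu> = Omega \<and> sets \<mu> = event_field \<and>
     (\<forall>k B r l. 1 \<le> k \<and> borel_family k B \<and> suborder {1..k} r \<and> linear_extension k r l \<longrightarrow>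
        measure \<mu> (basic_event k B r) =
        measure \<mu> (basic_event k (\<lambda>i. B (l i)) (perm_order l r)))"

definition extremal :: "outcome measure \<Rightarrow> bool" where
  "extremal \<mu> \<longleftrightarrow>
     \<not> (\<exists>r \<mu>\<^sub>1 \<mu>\<^sub>2. 0 < r \<and> r < 1 \<and> order_invariant \<mu>\<^sub>1 \<and> order_invariant \<mu>\<^sub>2 \<and> \<mu>\<^sub>1 \<noteq> \<mu>\<^sub>2 \<and>
          (\<forall>E\<in>event_field. measure \<mu> E = r * measure \<mu>\<^sub>1 E + (1 - r) * measure \<mu>\<^sub>2 E))"

definition nu :: "nat \<Rightarrow> outcome set \<Rightarrow> outcome \<Rightarrow> real" where
  "nu k E \<omega> =
     (let L = {l. linear_extension k (snd \<omega> \<inter> ({1..k} \<times> {1..k})) l}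
      in real (card {l \<in> L. perm_outcome l \<omega> \<in> E}) / real (card L))"

definition essential :: "outcome measure \<Rightarrow> bool" where
  "essential \<mu> \<longleftrightarrow> (\<forall>E\<in>event_field. AE \<omega> in \<mu>. (\<lambda>k. nu k E \<omega>) \<longlonglongrightarrow> measure \<mu> E)"

definition adj_swap :: "nat \<Rightarrow> outcome \<Rightarrow> outcome" where
  "adj_swap i \<omega> =
     (if (i, i + 1) \<in> snd \<omega> then \<omega> else perm_outcome (Transposition.transpose i (i + 1)) \<omega>)"

definition G_upto :: "nat \<Rightarrow> outcome set set" where
  "G_upto k = {H \<in> event_field. \<forall>\<omega>\<in>H. \<forall>i. 1 \<le> i \<and> i < k \<longrightarrow> adj_swap i \<omega> \<in> H}"

definition tail_field :: "outcome set set" where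
  "tail_field = (\<Inter>k\<in>{1..}. G_upto k)"

definition trivial_tails :: "outcome measure \<Rightarrow> bool" where
  "trivial_tails \<mu> \<longleftrightarrow> (\<forall>H\<in>tail_field. measure \<mu> H \<in> {0, 1})"

end

theory Submission
  imports Defs
begin

text \<open>
  Let \<open>G\<^sub>k\<close> stand for \<open>G_upto k\<close>. Everything rests on reading \<open>nu k E\<close> as the conditional probability of \<open>E\<close> given
  \<open>G\<^sub>k\<close>, simultaneously for all order-invariant measures. Bubble sort shows that invariance under adjacent swaps is
  invariance under all linear extensions (\<open>mem_G_upto\<close>), so the elements of \<open>G\<^sub>k\<close> are the events that are
  unions of orbits, and \<open>nu k E\<close> is the average of the indicator of \<open>E\<close> over an orbit. Order-invariance means
  that linear extensions preserve the measure fibre by fibre (\<open>transport\<close>), so averaging does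
  not change the expectation (\<open>expectation_nu\<close>), and symmetric events can be taken out of the average
  (\<open>nu_Int\<close>).

  The three implications are proved in a cycle. If \<open>\<mu>\<close> is extremal, its tails are trivial, because conditioning on a
  tail event and on its complement would otherwise decompose it.

  If the tails are trivial, \<open>\<mu>\<close> is essential: \<open>nu k E\<close> is a bounded reverse martingale for the decreasing
  \<open>\<sigma>\<close>-fields \<open>G\<^sub>k\<close> and so converges almost surely (\<open>reverse_martingale_converges\<close>, by orthogonality of
  increments and Kolmogorov's maximal inequality). The limit is a tail function, hence almost surely
  constant, and its expectation is the probability of \<open>E\<close>.

  If \<open>\<mu>\<close> is essential, let it be a mixture of two order-invariant measures. Both are
  absolutely continuous with respect to \<open>\<mu>\<close>, so under each of them \<open>nu k E\<close> converges almost surely to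
  \<open>\<mu>(E)\<close>. By dominated convergence and \<open>expectation_nu\<close> both components agree with \<open>\<mu>\<close> on \<open>E\<close>, and
  \<open>\<mu>\<close> is extremal.
\<close>

(* Positions start at 1; keeping 1 from becoming Suc 0 lets facts about {1..k} match. *)
declare One_nat_def [simp del]

section \<open>Almost sure convergence of bounded reverse martingales\<close>

text \<open>
  Reading a martingale backwards replaces the upcrossing argument by an \<open>L\<^sup>2\<close> argument. Increments
  are orthogonal, so the second moments \<open>a n\<close> decrease to a limit and \<open>a m\<close> - \<open>a n\<close> is the squared
  \<open>L\<^sup>2\<close> distance of \<open>X m\<close> and \<open>X n\<close>. For \<open>m \<le> k \<le> n\<close> the difference \<open>X k - X n\<close> is the conditional
  expectation of \<open>X m - X n\<close> given \<open>F k\<close>, so Kolmogorov's maximal inequality bounds the probability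
  of a large difference anywhere between \<open>m\<close> and \<open>n\<close> by a multiple of \<open>a m - a n\<close>. Since \<open>a\<close> is Cauchy,
  almost every path is Cauchy.
\<close>

lemma (in prob_space) reverse_martingale_converges:
  fixes F :: "nat \<Rightarrow> 'a measure" and X :: "nat \<Rightarrow> 'a \<Rightarrow> real" and C :: real
  assumes sub: "\<And>n. subalgebra M (F n)"
    and dec: "\<And>m n. m \<le> n \<Longrightarrow> sets (F n) \<subseteq> sets (F m)"
    and X: "\<And>n. X n \<in> borel_measurable (F n)"
    and bounded: "\<And>n x. \<bar>X n x\<bar> \<le> C"
    and mart: "\<And>m n A. m \<le> n \<Longrightarrow> A \<in> sets (F n) \<Longrightarrow>
      (\<integral>x\<in>A. X m x \<partial>M) = (\<integral>x\<in>A. X n x \<partial>M)"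
  shows "AE x in M. convergent (\<lambda>n. X n x)"
proof -
  have XF: "X m \<in> borel_measurable (F n)" if "n \<le> m" for m n
  proof -
    have "subalgebra (F n) (F m)"
      using sub[of n] sub[of m] dec[OF that] by (auto simp: subalgebra_def)
    from measurable_from_subalg[OF this X] show ?thesis .
  qed
  have toM: "g \<in> borel_measurable M" if "g \<in> borel_measurable (F n)" for g :: "'a \<Rightarrow> real" and n
    by (rule measurable_from_subalg[OF sub that])
  have XM[measurable]: "X n \<in> borel_measurable M" for n
    by (rule toM[OF X])
  have int: "integrable M g" if "g \<in> borel_measurable M" "\<And>x. \<bar>g x\<bar> \<le> c" for g :: "'a \<Rightarrow> real" and c
    by (rule integrable_const_bound[where B=c]) (use that in auto)
  have C0: "0 \<le> C" using bounded[of 0 undefined] by linarith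
  have Xint: "integrable M (X n)" for n by (rule int[OF XM bounded])
  \<comment> \<open>The martingale property extends from indicators to bounded factors: X n is a version of the
      conditional expectation of X m given F n.\<close>
  have orth: "(\<integral>x. g x * X m x \<partial>M) = (\<integral>x. g x * X n x \<partial>M)"
    if mn: "m \<le> n" and g: "g \<in> borel_measurable (F n)" and gb: "\<And>x. \<bar>g x\<bar> \<le> c" for g c m n
  proof -
    interpret S: finite_measure_subalgebra M "F n"
      by unfold_locales (rule sub)
    have "AE x in M. real_cond_exp M (F n) (X m) x = X n x"
      by (rule S.real_cond_exp_charact) (use mart[OF mn] Xint X in auto)
    moreover have "integrable M (\<lambda>x. g x * X m x)"
    proof (rule int)
      show "(\<lambda>x. g x * X m x) \<in> borel_measurable M" using toM[OF g] by measurable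
      show "\<bar>g x * X m x\<bar> \<le> c * C" for x
        unfolding abs_mult by (rule mult_mono) (use gb[of x] bounded[of m x] C0 in auto)
    qed
    then have "(\<integral>x. g x * X m x \<partial>M) = (\<integral>x. g x * real_cond_exp M (F n) (X m) x \<partial>M)"
      using S.real_cond_exp_intg(2)[OF _ g XM] by simp
    ultimately show ?thesis
      using toM[OF g] by (subst (asm) integral_cong_AE[of _ _ "\<lambda>x. g x * X n x"]) auto
  qed
  have prod_bound: "\<bar>a * b\<bar> \<le> p * q" if "\<bar>a\<bar> \<le> p" "\<bar>b\<bar> \<le> q" for a b p q :: real
    unfolding abs_mult by (rule mult_mono) (use that in auto)
  have diff_bound: "\<bar>X m x - X n x\<bar> \<le> 2 * C" for m n x
    using bounded[of m x] bounded[of n x] by linarith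
  have int_mult: "integrable M (\<lambda>x. g x * h x)"
    if "g \<in> borel_measurable M" "h \<in> borel_measurable M" "\<And>x. \<bar>g x\<bar> \<le> p" "\<And>x. \<bar>h x\<bar> \<le> q"
    for g h :: "'a \<Rightarrow> real" and p q
    by (rule int[of _ "p * q"]) (use that(1,2) prod_bound[OF that(3,4)] in auto)
  define a where "a n = (\<integral>x. (X n x)\<^sup>2 \<partial>M)" for n
  have sq_int: "integrable M (\<lambda>x. (X n x)\<^sup>2)" for n
    unfolding power2_eq_square by (rule int_mult[OF XM XM bounded bounded])
  \<comment> \<open>Orthogonality of X n and X m - X n.\<close>
  have pyth: "(\<integral>x. (X m x - X n x)\<^sup>2 \<partial>M) = a m - a n" if "m \<le> n" for m n
  proof -
    have i: "integrable M (\<lambda>x. X n x * X m x)"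
      by (rule int_mult[OF XM XM bounded bounded])
    have "(\<integral>x. (X m x - X n x)\<^sup>2 \<partial>M) = (\<integral>x. (X m x)\<^sup>2 + (X n x)\<^sup>2 - 2 * (X n x * X m x) \<partial>M)"
      by (rule Bochner_Integration.integral_cong) (auto simp: power2_eq_square algebra_simps)
    also have "\<dots> = a m + a n - 2 * (\<integral>x. X n x * X m x \<partial>M)"
      using sq_int i by (simp add: a_def)
    also have "(\<integral>x. X n x * X m x \<partial>M) = a n"
      using orth[OF that X bounded] by (simp add: a_def power2_eq_square)
    finally show ?thesis by simp
  qed
  have maximal: "\<epsilon>\<^sup>2 * prob {x \<in> space M. \<exists>k\<in>{m..n}. \<epsilon> \<le> \<bar>X k x - X n x\<bar>} \<le> a m - a n"
    if "m \<le> n" and \<epsilon>: "0 < \<epsilon>" for m n and \<epsilon> :: real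
  proof -
    \<comment> \<open>Split according to the last index k at which the deviation from X n is large. As F decreases,
        this event is known to F k, which is what makes the time-reversed stopping argument work.\<close>
    define A where "A k = {x \<in> space M. \<epsilon> \<le> \<bar>X k x - X n x\<bar> \<and>
                              (\<forall>j\<in>{k<..n}. \<bar>X j x - X n x\<bar> < \<epsilon>)}" for k
    have AF: "A k \<in> sets (F k)" if "k \<le> n" for k
    proof -
      have [measurable]: "X k \<in> borel_measurable (F k)" "X n \<in> borel_measurable (F k)"
        using XF that by auto
      have [measurable]: "X j \<in> borel_measurable (F k)" if "j \<in> {k<..n}" for j
        using XF that by auto
      have [measurable]: "Measurable.pred (F k) (\<lambda>x. \<bar>X j x - X n x\<bar> < \<epsilon>)" if "j \<in> {k<..n}" for j
        using that by measurable
      have "A k = {x \<in> space (F k). \<epsilon> \<le> \<bar>X k x - X n x\<bar> \<and>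
                              (\<forall>j\<in>{k<..n}. \<bar>X j x - X n x\<bar> < \<epsilon>)}"
        using sub[of k] by (simp add: A_def subalgebra_def)
      also have "\<dots> \<in> sets (F k)" by measurable
      finally show ?thesis .
    qed
    have AM: "A k \<in> sets M" if "k \<le> n" for k
      using AF[OF that] sub[of k] by (auto simp: subalgebra_def)
    have disj: "disjoint_family_on A {m..n}"
      unfolding disjoint_family_on_def
    proof (intro ballI impI)
      fix i j assume "i \<in> {m..n}" "j \<in> {m..n}" "i \<noteq> j"
      then show "A i \<inter> A j = {}"
        by (cases i j rule: linorder_cases) (force simp: A_def)+
    qed
    have union: "{x \<in> space M. \<exists>k\<in>{m..n}. \<epsilon> \<le> \<bar>X k x - X n x\<bar>} = (\<Union>k\<in>{m..n}. A k)" (is "?L = ?R")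
    proof
      show "?R \<subseteq> ?L" by (auto simp: A_def)
      show "?L \<subseteq> ?R"
      proof
        fix x assume x: "x \<in> ?L"
        let ?K = "{k \<in> {m..n}. \<epsilon> \<le> \<bar>X k x - X n x\<bar>}"
        have K: "finite ?K" "?K \<noteq> {}" using x by auto
        then have "Max ?K \<in> ?K" by (rule Max_in)
        moreover have "\<bar>X j x - X n x\<bar> < \<epsilon>" if "j \<in> {Max ?K<..n}" for j
        proof (rule ccontr)
          assume "\<not> ?thesis"
          then have "j \<in> ?K" using that \<open>Max ?K \<in> ?K\<close> by auto
          then have "j \<le> Max ?K" using K by (intro Max_ge) auto
          then show False using that by simp
        qed
        ultimately have "x \<in> A (Max ?K)" using x by (auto simp: A_def)
        then show "x \<in> ?R" using \<open>Max ?K \<in> ?K\<close> by blast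
      qed
    qed
    have iA: "integrable M (\<lambda>x. indicator (A k) x * (X m x - X n x)\<^sup>2)" if "k \<le> n" for k
    proof (rule int_mult)
      show "\<bar>indicator (A k) x :: real\<bar> \<le> 1" for x by (simp add: indicator_def)
      show "\<bar>(X m x - X n x)\<^sup>2\<bar> \<le> (2 * C) * (2 * C)" for x
        unfolding power2_eq_square by (rule prod_bound[OF diff_bound diff_bound])
    qed (use AM[OF that] in auto)
    have step: "\<epsilon>\<^sup>2 * prob (A k) \<le> (\<integral>x. indicator (A k) x * (X m x - X n x)\<^sup>2 \<partial>M)"
      if k: "k \<in> {m..n}" for k
    proof -
      define g where "g x = indicator (A k) x * (X k x - X n x)" for x
      have g: "g \<in> borel_measurable (F k)"
        unfolding g_def using AF k XF[of k n] X[of k] by auto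
      have gb: "\<bar>g x\<bar> \<le> 1 * (2 * C)" for x
        unfolding g_def by (intro prod_bound diff_bound) (auto simp: indicator_def)
      have gi: "integrable M (\<lambda>x. g x * X j x)" for j
        by (rule int_mult[OF toM[OF g] XM gb bounded])
      \<comment> \<open>The increment X m - X k is orthogonal to the F k-measurable g.\<close>
      have cross: "(\<integral>x. g x * X m x - g x * X k x \<partial>M) = 0"
        using orth[OF _ g gb, of m] gi k by simp
      have iI: "integrable M (indicat_real (A k))"
        using AM k by (intro int[of _ 1] borel_measurable_indicator) (auto simp: indicator_def)
      have "\<epsilon>\<^sup>2 * prob (A k) = (\<integral>x. \<epsilon>\<^sup>2 * indicator (A k) x \<partial>M)"
        using AM k by simp
      also have "\<dots> = (\<integral>x. \<epsilon>\<^sup>2 * indicator (A k) x + 2 * (g x * X m x - g x * X k x) \<partial>M)"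
        using iI gi cross by (subst Bochner_Integration.integral_add) auto
      also have "\<dots> \<le> (\<integral>x. indicator (A k) x * (X m x - X n x)\<^sup>2 \<partial>M)"
      proof (rule integral_mono)
        show "integrable M (\<lambda>x. \<epsilon>\<^sup>2 * indicator (A k) x + 2 * (g x * X m x - g x * X k x))"
          using iI gi by auto
        show "integrable M (\<lambda>x. indicator (A k) x * (X m x - X n x)\<^sup>2)"
          using iA k by auto
        fix x
        show "\<epsilon>\<^sup>2 * indicator (A k) x + 2 * (g x * X m x - g x * X k x)
                \<le> indicator (A k) x * (X m x - X n x)\<^sup>2"
        proof (cases "x \<in> A k")
          case True
          then have "\<epsilon>\<^sup>2 \<le> (X k x - X n x)\<^sup>2"
            using \<epsilon> by (subst abs_le_square_iff[symmetric]) (auto simp: A_def)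
          moreover have "0 \<le> (X m x - X k x)\<^sup>2" by simp
          \<comment> \<open>Expand the square of (X m - X k) + (X k - X n): the mixed term is the one in g.\<close>
          ultimately show ?thesis
            using True by (simp add: g_def power2_eq_square algebra_simps)
        qed (simp add: g_def)
      qed
      finally show ?thesis .
    qed
    have "\<epsilon>\<^sup>2 * prob {x \<in> space M. \<exists>k\<in>{m..n}. \<epsilon> \<le> \<bar>X k x - X n x\<bar>} = (\<Sum>k\<in>{m..n}. \<epsilon>\<^sup>2 * prob (A k))"
      unfolding union using AM disj
      by (subst finite_measure_finite_Union) (auto simp: sum_distrib_left)
    also have "\<dots> \<le> (\<Sum>k\<in>{m..n}. \<integral>x. indicator (A k) x * (X m x - X n x)\<^sup>2 \<partial>M)"
      by (rule sum_mono) (rule step)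
    also have "\<dots> = (\<integral>x. (\<Sum>k\<in>{m..n}. indicator (A k) x * (X m x - X n x)\<^sup>2) \<partial>M)"
      using iA by (subst Bochner_Integration.integral_sum) auto
    also have "\<dots> \<le> (\<integral>x. (X m x - X n x)\<^sup>2 \<partial>M)"
    proof (rule integral_mono)
      show "integrable M (\<lambda>x. \<Sum>k = m..n. indicator (A k) x * (X m x - X n x)\<^sup>2)"
        by (rule Bochner_Integration.integrable_sum) (use iA in simp)
      show "integrable M (\<lambda>x. (X m x - X n x)\<^sup>2)"
        unfolding power2_eq_square
        by (rule int_mult[OF _ _ diff_bound diff_bound]) auto
      fix x
      have "(\<Sum>k = m..n. indicator (A k) x * (X m x - X n x)\<^sup>2)
          = indicator (\<Union>k\<in>{m..n}. A k) x * (X m x - X n x)\<^sup>2"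
        unfolding sum_distrib_right[symmetric] by (simp only: indicator_UN_disjoint[OF _ disj] finite_atLeastAtMost)
      also have "\<dots> \<le> (X m x - X n x)\<^sup>2" by (simp add: indicator_def)
      finally show "(\<Sum>k = m..n. indicator (A k) x * (X m x - X n x)\<^sup>2) \<le> (X m x - X n x)\<^sup>2" .
    qed
    finally show ?thesis using pyth[OF that(1)] by simp
  qed
  have "decseq a"
    unfolding decseq_def
  proof (intro allI impI)
    fix m n :: nat assume "m \<le> n"
    then have "0 \<le> a m - a n" by (subst pyth[symmetric]) auto
    then show "a n \<le> a m" by simp
  qed
  moreover have a0: "0 \<le> a n" for n by (simp add: a_def)
  ultimately obtain L where L: "a \<longlonglongrightarrow> L" "\<And>n. L \<le> a n"
    using decseq_convergent by metis
  define B where "B \<epsilon> m = {x \<in> space M. \<exists>k\<ge>m. 2 * \<epsilon> \<le> \<bar>X k x - X m x\<bar>}" for \<epsilon> m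
  have tail_osc: "prob (B \<epsilon> m) \<le> (a m - L) / \<epsilon>\<^sup>2" if \<epsilon>: "0 < \<epsilon>" for \<epsilon> m
  proof -
    define D where "D n = {x \<in> space M. \<exists>k\<in>{m..n}. 2 * \<epsilon> \<le> \<bar>X k x - X m x\<bar>}" for n
    have DM: "D n \<in> sets M" for n unfolding D_def by measurable
    have "incseq D" by (auto simp: incseq_def D_def)
    then have "(\<lambda>n. prob (D n)) \<longlonglongrightarrow> prob (\<Union>n. D n)"
      using DM by (intro finite_Lim_measure_incseq) auto
    moreover have "(\<Union>n. D n) = B \<epsilon> m" by (force simp: D_def B_def)
    ultimately have "(\<lambda>n. prob (D n)) \<longlonglongrightarrow> prob (B \<epsilon> m)" by simp
    moreover have "prob (D n) \<le> (a m - L) / \<epsilon>\<^sup>2" if "m \<le> n" for n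
    proof -
      have "prob (D n) \<le> prob {x \<in> space M. \<exists>k\<in>{m..n}. \<epsilon> \<le> \<bar>X k x - X n x\<bar>}"
      proof (rule finite_measure_mono)
        show "D n \<subseteq> {x \<in> space M. \<exists>k\<in>{m..n}. \<epsilon> \<le> \<bar>X k x - X n x\<bar>}"
        proof
          fix x assume "x \<in> D n"
          then obtain k where k: "x \<in> space M" "k \<in> {m..n}" "2 * \<epsilon> \<le> \<bar>X k x - X m x\<bar>"
            by (auto simp: D_def)
          \<comment> \<open>The maximal inequality compares with X n, the oscillation with X m; passing through X n
              costs the factor 2.\<close>
          then have "\<epsilon> \<le> \<bar>X k x - X n x\<bar> \<or> \<epsilon> \<le> \<bar>X m x - X n x\<bar>" by linarith
          then show "x \<in> {x \<in> space M. \<exists>k\<in>{m..n}. \<epsilon> \<le> \<bar>X k x - X n x\<bar>}"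
            using k that by (auto intro: bexI[of _ k] bexI[of _ m])
        qed
      qed measurable
      also have "\<dots> \<le> (a m - a n) / \<epsilon>\<^sup>2"
        using maximal[OF that \<epsilon>] \<epsilon> by (simp add: field_simps)
      also have "\<dots> \<le> (a m - L) / \<epsilon>\<^sup>2"
        using L(2)[of n] by (simp add: divide_right_mono)
      finally show ?thesis .
    qed
    ultimately show ?thesis
      by (intro LIMSEQ_le_const2) auto
  qed
  have osc_null: "AE x in M. \<exists>m. \<forall>k\<ge>m. \<bar>X k x - X m x\<bar> < 2 * \<epsilon>" if \<epsilon>: "0 < \<epsilon>" for \<epsilon>
  proof -
    define N where "N = {x \<in> space M. \<forall>m. \<exists>k\<ge>m. 2 * \<epsilon> \<le> \<bar>X k x - X m x\<bar>}"
    have NM: "N \<in> sets M" unfolding N_def by measurable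
    have "prob N \<le> (a m - L) / \<epsilon>\<^sup>2" for m
    proof -
      have "B \<epsilon> m \<in> sets M" unfolding B_def by measurable
      then have "prob N \<le> prob (B \<epsilon> m)"
        by (intro finite_measure_mono) (auto simp: N_def B_def)
      then show ?thesis using tail_osc[OF \<epsilon>, of m] by simp
    qed
    moreover have "(\<lambda>m. (a m - L) / \<epsilon>\<^sup>2) \<longlonglongrightarrow> 0"
      using tendsto_divide[OF tendsto_diff[OF L(1) tendsto_const[of L]] tendsto_const[of "\<epsilon>\<^sup>2"]] \<epsilon>
      by simp
    ultimately have "prob N \<le> 0" by (intro LIMSEQ_le_const) auto
    then have "N \<in> null_sets M"
      using NM by (simp add: emeasure_eq_measure null_sets_def measure_le_0_iff)
    then show ?thesis
      by (rule AE_I') (auto simp: N_def not_less)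
  qed
  have "AE x in M. \<forall>j. \<exists>m. \<forall>k\<ge>m. \<bar>X k x - X m x\<bar> < 2 * (1 / real (Suc j))"
    by (subst AE_all_countable) (intro allI osc_null, simp)
  then show ?thesis
  proof (rule AE_mp, intro AE_I2 impI)
    fix x assume osc: "\<forall>j. \<exists>m. \<forall>k\<ge>m. \<bar>X k x - X m x\<bar> < 2 * (1 / real (Suc j))"
    have "Cauchy (\<lambda>n. X n x)"
    proof (rule metric_CauchyI)
      fix e :: real assume e: "0 < e"
      then obtain j where j: "1 / real (Suc j) < e / 4"
        using nat_approx_posE[of "e/4"] by auto
      obtain m where m: "\<And>k. k \<ge> m \<Longrightarrow> \<bar>X k x - X m x\<bar> < 2 * (1 / real (Suc j))"
        using osc by blast
      have "dist (X k x) (X l x) < e" if "k \<ge> m" "l \<ge> m" for k l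
        using m[OF that(1)] m[OF that(2)] j by (simp add: dist_real_def)
      then show "\<exists>m. \<forall>k\<ge>m. \<forall>l\<ge>m. dist (X k x) (X l x) < e" by blast
    qed
    then show "convergent (\<lambda>n. X n x)" by (rule Cauchy_convergent)
  qed
qed

section \<open>Linear extensions acting on outcomes\<close>

abbreviation restr :: "nat \<Rightarrow> (nat \<times> nat) set \<Rightarrow> (nat \<times> nat) set" where
  "restr k R \<equiv> R \<inter> ({1..k} \<times> {1..k})"

text \<open>
  Linear extensions are taken of the restriction to \<open>[k]\<close>, but the set is indexed by the whole order:
  the same notation then serves the order of an outcome and its finite restrictions, and composition
  and inversion of linear extensions need no bookkeeping of restrictions.
\<close>

definition lin_exts :: "nat \<Rightarrow> (nat \<times> nat) set \<Rightarrow> (nat \<Rightarrow> nat) set" where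
  "lin_exts k R = {l. linear_extension k (restr k R) l}"

lemma mem_perm_order [simp]: "(i, j) \<in> perm_order l R \<longleftrightarrow> (l i, l j) \<in> R"
  by (simp add: perm_order_def)

lemma perm_order_comp: "perm_order m (perm_order l R) = perm_order (l \<circ> m) R"
  by (auto simp: perm_order_def)

lemma perm_order_id [simp]: "perm_order id R = R"
  by (auto simp: perm_order_def)

lemma snd_perm_outcome [simp]: "snd (perm_outcome l \<omega>) = perm_order l (snd \<omega>)"
  by (simp add: perm_outcome_def)

lemma perm_outcome_comp: "perm_outcome m (perm_outcome l \<omega>) = perm_outcome (l \<circ> m) \<omega>"
  by (simp add: perm_outcome_def perm_order_comp)

lemma perm_outcome_id [simp]: "perm_outcome id \<omega> = \<omega>"
  by (simp add: perm_outcome_def)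

lemma mem_lin_exts:
  "l \<in> lin_exts k R \<longleftrightarrow>
     l permutes {1..k} \<and> (\<forall>i\<in>{1..k}. \<forall>j\<in>{1..k}. (l i, l j) \<in> R \<longrightarrow> i < j)"
proof (cases "l permutes {1..k}")
  case True
  from permutes_in_image[OF this] show ?thesis
    by (simp add: lin_exts_def linear_extension_def del: atLeastAtMost_iff)
qed (simp add: lin_exts_def linear_extension_def)

lemma lin_exts_restr [simp]: "lin_exts k (restr k R) = lin_exts k R"
  by (simp add: lin_exts_def Int_assoc)

lemma lin_exts_permutes: "l \<in> lin_exts k R \<Longrightarrow> l permutes {1..k}"
  by (simp add: mem_lin_exts)

lemma finite_lin_exts: "finite (lin_exts k R)"
  by (rule finite_subset[OF _ finite_permutations[of "{1..k}"]]) (auto simp: mem_lin_exts)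

lemma restr_restr: "k \<le> K \<Longrightarrow> restr k (restr K R) = restr k R"
  by auto

lemma perm_order_restr:
  assumes "l permutes {1..k}" "k \<le> K"
  shows "perm_order l (restr K R) = restr K (perm_order l R)"
proof -
  have "l permutes {1..K}" using assms by (auto intro: permutes_subset)
  note l = permutes_in_image[OF this]
  show ?thesis
    by (rule set_eqI) (simp add: split_paired_all l del: atLeastAtMost_iff)
qed

lemma suborder_restr: "suborder {1..} R \<Longrightarrow> suborder {1..k} (restr k R)"
  by (auto simp: suborder_def irrefl_def trans_def)

text \<open>
  Outside \<open>[k]\<close> a linear extension of the restriction to \<open>[k]\<close> fixes every point and inside it permutes
  \<open>[k]\<close>, so a pair with an entry above \<open>k\<close> is not reordered either; the defining property
  holds for all pairs.
\<close>

lemma lin_exts_order: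
  assumes R: "suborder A R" "A \<subseteq> {1..}" and l: "l \<in> lin_exts k R" and ij: "(l i, l j) \<in> R"
  shows "i < j"
proof -
  have p: "l permutes {1..k}" using l by (rule lin_exts_permutes)
  have lt: "l i < l j" "1 \<le> l i" "1 \<le> l j" using R ij by (auto simp: suborder_def)
  have out: "l n = n" if "n \<notin> {1..k}" for n using p that by (simp add: permutes_def)
  have "in": "1 \<le> l n \<and> l n \<le> k \<longleftrightarrow> 1 \<le> n \<and> n \<le> k" for n
    using permutes_in_image[OF p, of n] by simp
  show ?thesis
  proof (cases "i \<in> {1..k} \<and> j \<in> {1..k}")
    case True
    then show ?thesis using l ij by (auto simp: mem_lin_exts)
  next
    case False
    then consider "i \<notin> {1..k}" "j \<notin> {1..k}" | "i \<in> {1..k}" "j \<notin> {1..k}"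
      | "i \<notin> {1..k}" "j \<in> {1..k}" by blast
    then show ?thesis
    proof cases
      case 1
      then show ?thesis using lt out by simp
    next
      case 2
      then have "l j = j" by (blast intro: out)
      then show ?thesis using 2 lt by simp
    next
      case 3
      then have "l i = i" by (blast intro: out)
      then show ?thesis using 3 lt "in"[of j] by simp
    qed
  qed
qed

lemma suborder_perm_order:
  assumes R: "suborder A R" "A \<subseteq> {1..}" "{1..k} \<subseteq> A" and l: "l \<in> lin_exts k R"
  shows "suborder A (perm_order l R)"
proof -
  have "l permutes A" using R(3) lin_exts_permutes[OF l] by (auto intro: permutes_subset)
  then have "l i \<in> A \<longleftrightarrow> i \<in> A" for i by (rule permutes_in_image)
  moreover have "trans (perm_order l R)"
    using R(1) by (auto simp: suborder_def trans_def)
  ultimately show ?thesis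
    using R(1) lin_exts_order[OF R(1,2) l] by (auto simp: suborder_def irrefl_def)
qed

lemma inv_mem_lin_exts:
  assumes R: "suborder A R" and l: "l \<in> lin_exts k R"
  shows "inv l \<in> lin_exts k (perm_order l R)"
  using permutes_inv[OF lin_exts_permutes[OF l]] permutes_inverses(1)[OF lin_exts_permutes[OF l]] R
  by (auto simp: mem_lin_exts suborder_def)

lemma id_mem_lin_exts: "suborder A R \<Longrightarrow> id \<in> lin_exts k R"
  by (auto simp: mem_lin_exts suborder_def permutes_id)

lemma comp_mem_lin_exts:
  assumes "l \<in> lin_exts k R" "m \<in> lin_exts k (perm_order l R)"
  shows "l \<circ> m \<in> lin_exts k R"
  using assms by (auto simp: mem_lin_exts permutes_compose)

text \<open>
  The linear extensions of two outcomes that arise from one another by a linear extension correspond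
  bijectively. This is the reason why averages over linear extensions are constant along orbits.
\<close>

lemma lin_exts_image_comp:
  assumes R: "suborder A R" and l: "l \<in> lin_exts k R"
  shows "bij_betw (\<lambda>m. l \<circ> m) (lin_exts k (perm_order l R)) (lin_exts k R)"
proof (rule bij_betw_byWitness[where f'="\<lambda>m. inv l \<circ> m"])
  have p: "l permutes {1..k}" using l by (rule lin_exts_permutes)
  show "\<forall>m\<in>lin_exts k (perm_order l R). inv l \<circ> (l \<circ> m) = m"
    "\<forall>m\<in>lin_exts k R. l \<circ> (inv l \<circ> m) = m"
    using permutes_inv_o[OF p] by (simp_all add: o_assoc)
  show "(\<circ>) l ` lin_exts k (perm_order l R) \<subseteq> lin_exts k R"
    using comp_mem_lin_exts[OF l] by auto
  have "perm_order (inv l) (perm_order l R) = R"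
    using permutes_inv_o[OF p] by (simp add: perm_order_comp)
  moreover have "inv l \<in> lin_exts k (perm_order l R)" using R l by (rule inv_mem_lin_exts)
  ultimately show "(\<circ>) (inv l) ` lin_exts k R \<subseteq> lin_exts k (perm_order l R)"
    using comp_mem_lin_exts[of "inv l" k "perm_order l R"] by auto
qed

lemma Omega_suborder: "\<omega> \<in> Omega \<Longrightarrow> suborder {1..} (snd \<omega>)"
  by (auto simp: Omega_def)

lemma perm_outcome_in_Omega:
  assumes w: "\<omega> \<in> Omega" and l: "l \<in> lin_exts k (snd \<omega>)"
  shows "perm_outcome l \<omega> \<in> Omega"
proof -
  have "suborder {1..} (perm_order l (snd \<omega>))"
    by (rule suborder_perm_order[OF Omega_suborder[OF w] _ _ l]) auto
  moreover have "(\<lambda>i. fst \<omega> (l i)) \<in> {1..} \<rightarrow>\<^sub>E {0..1}"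
  proof -
    have "l permutes {1..}" using lin_exts_permutes[OF l] by (auto intro: permutes_subset)
    then have "l i \<in> {1..} \<longleftrightarrow> i \<in> {1..}" for i by (rule permutes_in_image)
    moreover have x: "fst \<omega> \<in> {1..} \<rightarrow>\<^sub>E {0..1}" using w by (simp add: Omega_def mem_Times_iff)
    ultimately show ?thesis
      by (intro PiE_I) (blast intro: PiE_mem[OF x], blast intro: PiE_arb[OF x])
  qed
  ultimately show ?thesis by (simp add: Omega_def perm_outcome_def)
qed

lemma perm_outcome_inv:
  assumes "l permutes S"
  shows "perm_outcome (inv l) (perm_outcome l \<omega>) = \<omega>"
  using permutes_inv_o[OF assms] by (simp add: perm_outcome_comp)

text \<open>
  Exchanging two neighbouring incomparable positions is a linear extension, and so is the identity, which
  is the action of \<open>adj_swap\<close> on comparable neighbours.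
\<close>

lemma adj_swap_eq_perm_outcome:
  assumes w: "\<omega> \<in> Omega" and i: "1 \<le> i" "i < k"
  shows "\<exists>l\<in>lin_exts k (snd \<omega>). adj_swap i \<omega> = perm_outcome l \<omega>"
proof (cases "(i, i + 1) \<in> snd \<omega>")
  case True
  then show ?thesis
    using id_mem_lin_exts[OF Omega_suborder[OF w], of k] by (intro bexI[of _ id]) (auto simp: adj_swap_def)
next
  case False
  have "Transposition.transpose i (i+1) \<in> lin_exts k (snd \<omega>)"
    unfolding mem_lin_exts
  proof (intro conjI ballI impI)
    show "Transposition.transpose i (i+1) permutes {1..k}"
      using i by (intro permutes_swap_id) auto
    fix a b
    assume "(Transposition.transpose i (i+1) a, Transposition.transpose i (i+1) b) \<in> snd \<omega>"
    moreover from this have "Transposition.transpose i (i+1) a < Transposition.transpose i (i+1) b"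
      using Omega_suborder[OF w] by (auto simp: suborder_def)
    ultimately show "a < b"
      using False by (auto simp: Transposition.transpose_def split: if_splits)
  qed
  then show ?thesis using False by (auto simp: adj_swap_def)
qed

text \<open>
  An injective map that is weakly increasing on \<open>[k]\<close> is strictly increasing there, hence lies above
  the identity; a permutation of \<open>[k]\<close> with this property is the identity.
\<close>

lemma permutes_eq_id_if_no_descent:
  fixes l :: "nat \<Rightarrow> nat"
  assumes l: "l permutes {1..k}" and asc: "\<And>i. 1 \<le> i \<Longrightarrow> i < k \<Longrightarrow> l i \<le> l (i + 1)"
  shows "l = id"
proof (rule permutes_natset_ge[OF l], rule ballI)
  fix i assume "i \<in> {1..k}"
  then have "1 \<le> i" "i \<le> k" by auto
  then show "i \<le> l i"
  proof (induction i rule: dec_induct)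
    case base
    then show ?case using permutes_in_image[OF l, of 1] by auto
  next
    case (step i)
    have "l i \<noteq> l (Suc i)" using permutes_inj[OF l] by (simp add: inj_eq)
    then show ?case using step asc[of i, folded Suc_eq_plus1] by auto
  qed
qed

text \<open>
  Bubble sort: a linear extension other than the identity has a descent \<open>l (i + 1) < l i\<close>. The values
  there are incomparable in the order, so exchanging them gives a linear extension nearer to the identity, from
  which the original one is recovered by one adjacent swap. The weighted sum in the
  induction strictly decreases when a descent is removed.
\<close>

lemma adj_swap_closed_imp_perm_closed:
  assumes H: "H \<subseteq> Omega" "\<And>\<omega> i. \<omega> \<in> H \<Longrightarrow> 1 \<le> i \<Longrightarrow> i < k \<Longrightarrow> adj_swap i \<omega> \<in> H"
    and w: "\<omega> \<in> H" and l: "l \<in> lin_exts k (snd \<omega>)"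
  shows "perm_outcome l \<omega> \<in> H"
  using l
proof (induction "\<Sum>i\<in>{1..k}. i * (k - l i)" arbitrary: l rule: less_induct)
  case less
  have p: "l permutes {1..k}" using less.prems by (rule lin_exts_permutes)
  have R: "suborder {1..} (snd \<omega>)" using w H(1) by (blast intro: Omega_suborder)
  show ?case
  proof (cases "\<exists>i. 1 \<le> i \<and> i < k \<and> l (i + 1) < l i")
    case False
    then have "l = id" using p by (intro permutes_eq_id_if_no_descent) (auto simp: not_less)
    then show ?thesis using w by simp
  next
    case True
    then obtain i where i: "1 \<le> i" "i < k" "l (i + 1) < l i" by blast
    let ?t = "Transposition.transpose i (i+1)"
    let ?\<omega> = "perm_outcome (l \<circ> ?t) \<omega>"
    have nc: "(l i, l (i + 1)) \<notin> snd \<omega>" using R i(3) unfolding suborder_def by (meson less_asym)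
    have "(l (i + 1), l i) \<notin> snd \<omega>"
      using lin_exts_order[OF R _ less.prems, of "i+1" i] by auto
    have t: "?t \<in> lin_exts k (perm_order l (snd \<omega>))"
      unfolding mem_lin_exts
    proof (intro conjI ballI impI)
      show "?t permutes {1..k}" using i by (intro permutes_swap_id) auto
      fix a b assume ab: "(?t a, ?t b) \<in> perm_order l (snd \<omega>)"
      then have "?t a < ?t b" using lin_exts_order[OF R _ less.prems] by auto
      with ab nc show "a < b"
        by (auto simp: Transposition.transpose_def split: if_splits)
    qed
    have lt: "l \<circ> ?t \<in> lin_exts k (snd \<omega>)"
      using less.prems t by (rule comp_mem_lin_exts)
    have "(\<Sum>j\<in>{1..k}. j * (k - (l \<circ> ?t) j)) < (\<Sum>j\<in>{1..k}. j * (k - l j))"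
    proof -
      have split: "sum f {1..k} = sum f ({1..k} - {i, i+1}) + (f i + f (i+1))" for f :: "nat \<Rightarrow> nat"
        using i by (subst sum.subset_diff[of "{i, i+1}"]) auto
      have "(\<Sum>j\<in>{1..k} - {i, i+1}. j * (k - (l \<circ> ?t) j)) = (\<Sum>j\<in>{1..k} - {i, i+1}. j * (k - l j))"
        by (rule sum.cong) (auto simp: Transposition.transpose_def)
      moreover have "i * (k - l (i+1)) + (i+1) * (k - l i) < i * (k - l i) + (i+1) * (k - l (i+1))"
      proof -
        have swap: "i * q + (i+1) * p < i * p + (i+1) * q" if "p < q" for p q :: nat
          using that by (simp add: algebra_simps)
        have "l i \<le> k" using i permutes_in_image[OF p, of i] by simp
        then show ?thesis using i(3) by (intro swap) simp
      qed
      ultimately show ?thesis by (subst (1 2) split) simp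
    qed
    then have "?\<omega> \<in> H" using lt by (rule less.hyps)
    then have "adj_swap i ?\<omega> \<in> H" using H(2) i by blast
    also have "adj_swap i ?\<omega> = perm_outcome l \<omega>"
      using \<open>(l (i + 1), l i) \<notin> snd \<omega>\<close>
      by (simp add: adj_swap_def perm_outcome_comp comp_assoc)
    finally show ?thesis .
  qed
qed

section \<open>Symmetric events\<close>

lemma basic_events_subset: "basic_events \<subseteq> Pow Omega"
  by (auto simp: basic_events_def basic_event_def)

lemma sigma_algebra_event_field: "sigma_algebra Omega event_field"
  unfolding event_field_def by (rule sigma_algebra_sigma_sets[OF basic_events_subset])

interpretation event_field: sigma_algebra Omega event_field
  by (rule sigma_algebra_event_field)

text \<open>
  Adjacent swaps generate the action of all linear extensions, so invariance under the former, which
  defines \<open>G_upto\<close>, may be replaced by invariance under the latter.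
\<close>

lemma mem_G_upto:
  "H \<in> G_upto k \<longleftrightarrow>
     H \<in> event_field \<and> (\<forall>\<omega>\<in>H. \<forall>l\<in>lin_exts k (snd \<omega>). perm_outcome l \<omega> \<in> H)"
proof
  assume "H \<in> G_upto k"
  then have H: "H \<in> event_field" "\<And>\<omega> i. \<omega> \<in> H \<Longrightarrow> 1 \<le> i \<Longrightarrow> i < k \<Longrightarrow> adj_swap i \<omega> \<in> H"
    by (auto simp: G_upto_def)
  have "H \<subseteq> Omega" using H(1) by (rule event_field.sets_into_space)
  from adj_swap_closed_imp_perm_closed[OF this H(2)] H(1)
  show "H \<in> event_field \<and> (\<forall>\<omega>\<in>H. \<forall>l\<in>lin_exts k (snd \<omega>). perm_outcome l \<omega> \<in> H)" by blast
next
  assume H: "H \<in> event_field \<and> (\<forall>\<omega>\<in>H. \<forall>l\<in>lin_exts k (snd \<omega>). perm_outcome l \<omega> \<in> H)"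
  then have "H \<subseteq> Omega" using event_field.sets_into_space by blast
  with H show "H \<in> G_upto k"
    unfolding G_upto_def using adj_swap_eq_perm_outcome by fastforce
qed

text \<open>
  Symmetric events contain the image of each of their outcomes; the inverse permutation is a
  linear extension of the image and leads back, which gives the converse. In particular \<open>G_upto k\<close> is closed under complements.
\<close>

lemma perm_outcome_mem_G_upto_iff:
  assumes H: "H \<in> G_upto k" and w: "\<omega> \<in> Omega" and l: "l \<in> lin_exts k (snd \<omega>)"
  shows "perm_outcome l \<omega> \<in> H \<longleftrightarrow> \<omega> \<in> H"
proof
  assume "perm_outcome l \<omega> \<in> H"
  moreover have "inv l \<in> lin_exts k (snd (perm_outcome l \<omega>))"
    using inv_mem_lin_exts[OF Omega_suborder[OF w] l] by simp
  ultimately have "perm_outcome (inv l) (perm_outcome l \<omega>) \<in> H"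
    using H by (auto simp: mem_G_upto)
  then show "\<omega> \<in> H" using perm_outcome_inv[OF lin_exts_permutes[OF l]] by simp
qed (use H l in \<open>auto simp: mem_G_upto\<close>)

lemma G_upto_antimono: "m \<le> n \<Longrightarrow> G_upto n \<subseteq> G_upto m"
  by (auto simp: G_upto_def)

lemma sigma_algebra_G_upto: "sigma_algebra Omega (G_upto k)"
proof (rule sigma_algebra_iff2[THEN iffD2], intro conjI ballI allI impI)
  show "G_upto k \<subseteq> Pow Omega"
    using event_field.sets_into_space by (auto simp: G_upto_def)
  show "{} \<in> G_upto k" by (simp add: G_upto_def)
  show "Omega - H \<in> G_upto k" if H: "H \<in> G_upto k" for H
    unfolding mem_G_upto
  proof (intro conjI ballI)
    show "Omega - H \<in> event_field" using H by (auto simp: mem_G_upto)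
    show "perm_outcome l \<omega> \<in> Omega - H" if "\<omega> \<in> Omega - H" "l \<in> lin_exts k (snd \<omega>)" for \<omega> l
      using that perm_outcome_mem_G_upto_iff[OF H] perm_outcome_in_Omega by blast
  qed
  show "\<Union> (range A) \<in> G_upto k" if "range A \<subseteq> G_upto k" for A :: "nat \<Rightarrow> _"
    using that by (fastforce simp: G_upto_def)
qed

section \<open>The proportion of linear extensions that lead into an event\<close>

lemma nu_eq_sum:
  "nu k E \<omega> = (\<Sum>l\<in>lin_exts k (snd \<omega>). indicator E (perm_outcome l \<omega>)) / card (lin_exts k (snd \<omega>))"
proof -
  have "(\<Sum>l\<in>lin_exts k (snd \<omega>). indicator E (perm_outcome l \<omega>))
      = real (card {l \<in> lin_exts k (snd \<omega>). perm_outcome l \<omega> \<in> E})"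
    by (simp add: indicator_def finite_lin_exts Int_def)
  then show ?thesis by (simp add: nu_def lin_exts_def Let_def)
qed

lemma nu_bounded: "0 \<le> nu k E \<omega>" "nu k E \<omega> \<le> 1"
proof -
  let ?L = "lin_exts k (snd \<omega>)"
  have "(\<Sum>l\<in>?L. indicator E (perm_outcome l \<omega>)) \<le> (\<Sum>l\<in>?L. 1 :: real)"
    by (rule sum_mono) (simp add: indicator_def)
  then show "nu k E \<omega> \<le> 1"
    by (auto simp: nu_eq_sum divide_le_eq)
  show "0 \<le> nu k E \<omega>" by (auto simp: nu_eq_sum intro!: divide_nonneg_nonneg sum_nonneg)
qed

lemma abs_nu_le_1: "\<bar>nu k E \<omega>\<bar> \<le> 1"
  using nu_bounded[where k=k and E=E and \<omega>=\<omega>] by linarith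

lemma card_lin_exts_pos: "suborder A R \<Longrightarrow> 0 < card (lin_exts k R)"
  using id_mem_lin_exts[of A R k] finite_lin_exts[of k R] by (auto simp: card_gt_0_iff)

lemma card_lin_exts_perm_order:
  assumes "suborder A R" "l \<in> lin_exts k R"
  shows "card (lin_exts k (perm_order l R)) = card (lin_exts k R)"
  by (rule bij_betw_same_card[OF lin_exts_image_comp[OF assms]])

lemma nu_perm_outcome:
  assumes w: "\<omega> \<in> Omega" and l: "l \<in> lin_exts k (snd \<omega>)"
  shows "nu k E (perm_outcome l \<omega>) = nu k E \<omega>"
proof -
  note R = Omega_suborder[OF w]
  have "(\<Sum>m\<in>lin_exts k (perm_order l (snd \<omega>)). indicator E (perm_outcome (l \<circ> m) \<omega>) :: real)
      = (\<Sum>m\<in>lin_exts k (snd \<omega>). indicator E (perm_outcome m \<omega>))"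
    by (rule sum.reindex_bij_betw[OF lin_exts_image_comp[OF R l]])
  then show ?thesis
    by (simp add: nu_eq_sum perm_outcome_comp card_lin_exts_perm_order[OF R l])
qed

text \<open>
  Membership in a symmetric event is constant along an orbit, so it can be taken out of the
  average: this is the identity that makes \<open>nu k E\<close> a conditional probability given \<open>G_upto k\<close>.
\<close>

lemma nu_Int:
  assumes H: "H \<in> G_upto k" and w: "\<omega> \<in> Omega"
  shows "nu k (E \<inter> H) \<omega> = indicator H \<omega> * nu k E \<omega>"
proof -
  have "(\<Sum>l\<in>lin_exts k (snd \<omega>). indicator (E \<inter> H) (perm_outcome l \<omega>) :: real)
      = (\<Sum>l\<in>lin_exts k (snd \<omega>). indicator H \<omega> * indicator E (perm_outcome l \<omega>))"
    by (rule sum.cong) (simp_all add: indicator_inter_arith indicator_def[of H] perm_outcome_mem_G_upto_iff[OF H w])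
  also have "\<dots> = indicator H \<omega> * (\<Sum>l\<in>lin_exts k (snd \<omega>). indicator E (perm_outcome l \<omega>))"
    by (rule sum_distrib_left[symmetric])
  finally show ?thesis
    unfolding nu_eq_sum times_divide_eq_right by (rule arg_cong)
qed

section \<open>Basic events and the fibres of the finite restriction\<close>

definition fibre :: "nat \<Rightarrow> (nat \<times> nat) set \<Rightarrow> outcome set" where
  "fibre k r = {\<omega> \<in> Omega. restr k (snd \<omega>) = r}"

lemma mem_basic_event:
  "\<omega> \<in> basic_event k B r \<longleftrightarrow> \<omega> \<in> Omega \<and> (\<forall>i\<in>{1..k}. fst \<omega> i \<in> B i) \<and> restr k (snd \<omega>) = r"
  by (cases \<omega>) (simp add: basic_event_def)

lemma fibre_eq_basic_event: "fibre k r = basic_event k (\<lambda>_. {0..1}) r"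
proof (rule set_eqI)
  fix \<omega> :: outcome
  have "fst \<omega> i \<in> {0..1}" if "\<omega> \<in> Omega" "i \<in> {1..k}" for i
  proof -
    have "fst \<omega> \<in> {1..} \<rightarrow>\<^sub>E {0..1}" using that(1) by (simp add: Omega_def mem_Times_iff)
    then show ?thesis by (rule PiE_mem) (use that(2) in simp)
  qed
  then show "\<omega> \<in> fibre k r \<longleftrightarrow> \<omega> \<in> basic_event k (\<lambda>_. {0..1}) r"
    unfolding fibre_def mem_basic_event by blast
qed

text \<open>
  The longer of two basic events determines the order on the shorter initial segment, so the two orders are
  either compatible, and the longer one survives, or the intersection is empty.
\<close>

lemma basic_event_Int:
  assumes "k \<le> K"
  shows "basic_event k B r \<inter> basic_event K C s =
    (if restr k s = r then basic_event K (\<lambda>i. if i \<le> k then B i \<inter> C i else C i) s else {})"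
proof -
  have key: "restr k (snd \<omega>) = restr k s" if "restr K (snd \<omega>) = s" for \<omega> :: outcome
    using restr_restr[OF assms, of "snd \<omega>"] that by simp
  have fac: "(\<forall>i\<in>{1..k}. f i \<in> B i) \<and> (\<forall>i\<in>{1..K}. f i \<in> C i)
      \<longleftrightarrow> (\<forall>i\<in>{1..K}. f i \<in> (if i \<le> k then B i \<inter> C i else C i))" for f :: "nat \<Rightarrow> real"
    using assms by auto
  show ?thesis
  proof (rule set_eqI)
    fix \<omega> :: outcome
    have "\<omega> \<in> basic_event k B r \<inter> basic_event K C s \<longleftrightarrow>
        \<omega> \<in> Omega \<and> ((\<forall>i\<in>{1..k}. fst \<omega> i \<in> B i) \<and> (\<forall>i\<in>{1..K}. fst \<omega> i \<in> C i)) \<and>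
        restr k (snd \<omega>) = r \<and> restr K (snd \<omega>) = s"
      unfolding Int_iff mem_basic_event by blast
    also have "\<dots> \<longleftrightarrow> \<omega> \<in> Omega \<and> (\<forall>i\<in>{1..K}. fst \<omega> i \<in> (if i \<le> k then B i \<inter> C i else C i)) \<and>
        restr k s = r \<and> restr K (snd \<omega>) = s"
      unfolding fac using key[of \<omega>] by (cases "restr K (snd \<omega>) = s") (simp_all only:, simp_all)
    finally have mem: "\<omega> \<in> basic_event k B r \<inter> basic_event K C s \<longleftrightarrow>
        \<omega> \<in> basic_event K (\<lambda>i. if i \<le> k then B i \<inter> C i else C i) s \<and> restr k s = r"
      unfolding mem_basic_event[of \<omega> K] by blast
    show "\<omega> \<in> basic_event k B r \<inter> basic_event K C s \<longleftrightarrow>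
        \<omega> \<in> (if restr k s = r then basic_event K (\<lambda>i. if i \<le> k then B i \<inter> C i else C i) s else {})"
      unfolding mem by (cases "restr k s = r") (simp_all only: if_P if_not_P simp_thms empty_iff)
  qed
qed

lemma basic_eventI:
  "1 \<le> k \<Longrightarrow> borel_family k B \<Longrightarrow> suborder {1..k} r \<Longrightarrow> basic_event k B r \<in> basic_events"
  by (auto simp: basic_events_def)

lemma empty_mem_basic_events: "{} \<in> basic_events"
proof -
  have "basic_event 1 (\<lambda>_. {}) {} \<in> basic_events"
    by (rule basic_eventI) (auto simp: borel_family_def suborder_def irrefl_def trans_def)
  moreover have "basic_event 1 (\<lambda>_. {}) {} = {}" by (auto simp: mem_basic_event)
  ultimately show ?thesis by simp
qed

text \<open>
  The one-point set \<open>[1]\<close> carries only the empty suborder.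
\<close>

lemma Omega_mem_basic_events: "Omega \<in> basic_events"
proof -
  have "basic_event 1 (\<lambda>_. {0..1}) {} \<in> basic_events"
    by (rule basic_eventI) (auto simp: borel_family_def suborder_def irrefl_def trans_def)
  moreover have "restr 1 (snd \<omega>) = {}" if "\<omega> \<in> Omega" for \<omega>
    using Omega_suborder[OF that] by (auto simp: suborder_def irrefl_def)
  then have "fibre 1 {} = Omega" by (auto simp: fibre_def)
  ultimately show ?thesis by (simp add: fibre_eq_basic_event)
qed

lemma Int_stable_basic_events: "Int_stable basic_events"
proof -
  have *: "basic_event k B r \<inter> basic_event K C s \<in> basic_events"
    if "k \<le> K" "1 \<le> k" "borel_family k B" "borel_family K C" "suborder {1..K} s" for k K B C r s
  proof -
    have "basic_event K (\<lambda>i. if i \<le> k then B i \<inter> C i else C i) s \<in> basic_events"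
      by (rule basic_eventI) (use that in \<open>auto simp: borel_family_def\<close>)
    then show ?thesis using empty_mem_basic_events by (simp add: basic_event_Int[OF that(1)])
  qed
  show ?thesis
  proof (rule Int_stableI)
    fix a b assume "a \<in> basic_events" "b \<in> basic_events"
    then obtain k B r K C s where
      a: "a = basic_event k B r" "1 \<le> k" "borel_family k B" "suborder {1..k} r" and
      b: "b = basic_event K C s" "1 \<le> K" "borel_family K C" "suborder {1..K} s"
      unfolding basic_events_def by blast
    show "a \<inter> b \<in> basic_events"
    proof (cases "k \<le> K")
      case True
      then show ?thesis unfolding a(1) b(1) using a b by (intro *)
    next
      case False
      then have "b \<inter> a \<in> basic_events" unfolding a(1) b(1) using a b by (intro *) simp_all
      then show ?thesis by (simp only: Int_commute)
    qed
  qed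
qed

text \<open>
  Inside a fibre at level \<open>k\<close> every basic event is a basic event of level at least \<open>k\<close>. A
  permutation of \<open>[k]\<close> then acts on it by permuting its factors and its order.
\<close>

lemma basic_event_Int_fibre:
  assumes B: "1 \<le> k'" "borel_family k' B" "suborder {1..k'} r" and s: "suborder {1..k} s"
  obtains (empty) "basic_event k' B r \<inter> fibre k s = {}"
  | (basic) K C t where "k \<le> K" "1 \<le> K" "borel_family K C" "suborder {1..K} t" "restr k t = s"
      "basic_event k' B r \<inter> fibre k s = basic_event K C t"
proof (cases "k \<le> k'")
  case True
  let ?C = "\<lambda>i. if i \<le> k then {0..1} \<inter> B i else B i"
  have eq: "basic_event k' B r \<inter> fibre k s = (if restr k r = s then basic_event k' ?C r else {})"
    unfolding fibre_eq_basic_event Int_commute[of "basic_event k' B r"] by (rule basic_event_Int[OF True])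
  have C: "borel_family k' ?C" using B(2) by (auto simp: borel_family_def)
  show thesis
  proof (cases "restr k r = s")
    case rs: True
    show thesis
      using eq by (intro basic[OF True B(1) C B(3) rs]) (simp only: rs if_True refl)
  next
    case False
    show thesis by (rule empty) (simp only: eq False if_False)
  qed
next
  case False
  then have k: "k' \<le> k" "1 \<le> k" using B(1) by simp_all
  let ?C = "\<lambda>i. if i \<le> k' then B i \<inter> {0..1} else {0..1}"
  have eq: "basic_event k' B r \<inter> fibre k s = (if restr k' s = r then basic_event k ?C s else {})"
    unfolding fibre_eq_basic_event by (rule basic_event_Int[OF k(1)])
  have C: "borel_family k ?C" using B(2) by (auto simp: borel_family_def)
  have ss: "restr k s = s" using s by (auto simp: suborder_def)
  show thesis
  proof (cases "restr k' s = r")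
    case rs: True
    show thesis
      using eq by (intro basic[OF order_refl k(2) C s ss]) (simp only: rs if_True refl)
  next
    case False
    show thesis by (rule empty) (simp only: eq False if_False)
  qed
qed

lemma fibre_mem_event_field:
  assumes "suborder {1..k} r"
  shows "fibre k r \<in> event_field"
proof (cases "k = 0")
  case True
  then have "r = {}" using assms by (simp add: suborder_def)
  then have "fibre k r = Omega" using True by (simp add: fibre_def)
  then show ?thesis using event_field.top by simp
next
  case False
  then have "fibre k r \<in> basic_events"
    using assms unfolding fibre_eq_basic_event by (intro basic_eventI) (simp_all add: borel_family_def)
  then show ?thesis by (simp add: event_field_def sigma_sets.Basic)
qed

lemma perm_outcome_vimage_basic_event:
  assumes r: "suborder {1..k} r" and l: "l \<in> lin_exts k r" and K: "k \<le> K"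
    and t: "restr k t = perm_order l r"
  shows "{\<omega> \<in> fibre k r. perm_outcome l \<omega> \<in> basic_event K C t}
       = basic_event K (\<lambda>i. C (inv l i)) (perm_order (inv l) t)" (is "?L = ?R")
proof -
  have p: "l permutes {1..k}" using l by (rule lin_exts_permutes)
  have pK: "l permutes {1..K}" using p K by (auto intro: permutes_subset)
  have pi: "inv l permutes {1..k}" by (rule permutes_inv[OF p])
  have inK: "l i \<in> {1..K} \<longleftrightarrow> i \<in> {1..K}" "inv l i \<in> {1..K} \<longleftrightarrow> i \<in> {1..K}" for i
    using permutes_in_image[OF pK] permutes_in_image[OF permutes_inv[OF pK]] by auto
  have il: "perm_order (inv l) (perm_order l S) = S" "perm_order l (perm_order (inv l) S) = S" for S
    using permutes_inv_o[OF p] by (simp_all add: perm_order_comp)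
  have li: "l (inv l i) = i" "inv l (l i) = i" for i
    using permutes_inverses[OF p] by auto
  show ?thesis
  proof (intro set_eqI iffI)
    fix \<omega> assume w: "\<omega> \<in> ?L"
    then have "restr K (perm_order l (snd \<omega>)) = t" by (simp add: mem_basic_event)
    then have "restr K (snd \<omega>) = perm_order (inv l) t"
      using perm_order_restr[OF p K, of "snd \<omega>"] il by metis
    moreover have "fst \<omega> i \<in> C (inv l i)" if "i \<in> {1..K}" for i
    proof -
      have "inv l i \<in> {1..K}" using inK that by blast
      then have "fst (perm_outcome l \<omega>) (inv l i) \<in> C (inv l i)"
        using w by (auto simp: mem_basic_event)
      then show ?thesis by (simp add: perm_outcome_def li)
    qed
    ultimately show "\<omega> \<in> ?R" using w by (auto simp: mem_basic_event fibre_def)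
  next
    fix \<omega> assume w: "\<omega> \<in> ?R"
    then have O: "\<omega> \<in> Omega" and R: "restr K (snd \<omega>) = perm_order (inv l) t"
      by (auto simp: mem_basic_event)
    have "restr k (snd \<omega>) = restr k (perm_order (inv l) t)"
      using restr_restr[OF K] R by metis
    also have "\<dots> = r"
      using perm_order_restr[OF pi order_refl, of t] t il by simp
    finally have wr: "\<omega> \<in> fibre k r" using O by (simp add: fibre_def)
    have "l \<in> lin_exts k (snd \<omega>)"
      using l wr by (metis (mono_tags, lifting) fibre_def lin_exts_restr mem_Collect_eq)
    then have "perm_outcome l \<omega> \<in> Omega" by (rule perm_outcome_in_Omega[OF O])
    moreover have "restr K (perm_order l (snd \<omega>)) = t"
      using perm_order_restr[OF p K, of "snd \<omega>"] R il by metis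
    moreover have "fst (perm_outcome l \<omega>) i \<in> C i" if "i \<in> {1..K}" for i
    proof -
      have "l i \<in> {1..K}" using inK that by blast
      then have "fst \<omega> (l i) \<in> C (inv l (l i))" using w by (auto simp: mem_basic_event)
      then show ?thesis by (simp add: perm_outcome_def li)
    qed
    ultimately show "\<omega> \<in> ?L" using wr by (auto simp: mem_basic_event)
  qed
qed

lemma lin_exts_fibre: "\<omega> \<in> fibre k r \<Longrightarrow> lin_exts k (snd \<omega>) = lin_exts k r"
  by (auto simp: fibre_def simp flip: lin_exts_restr[of k "snd \<omega>"])

lemma perm_outcome_in_fibre:
  assumes "\<omega> \<in> fibre k r" "l \<in> lin_exts k r"
  shows "perm_outcome l \<omega> \<in> fibre k (perm_order l r)"
proof -
  have "perm_outcome l \<omega> \<in> Omega"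
    using assms by (intro perm_outcome_in_Omega[of _ _ k]) (simp_all add: lin_exts_fibre, simp add: fibre_def)
  moreover have "restr k (perm_order l (snd \<omega>)) = perm_order l r"
    using perm_order_restr[OF lin_exts_permutes[OF assms(2)] order_refl, of "snd \<omega>"] assms(1)
    by (simp add: fibre_def)
  ultimately show ?thesis by (simp add: fibre_def)
qed

section \<open>Conditional probabilities under an order-invariant measure\<close>

locale order_invariant_measure = prob_space \<mu> for \<mu> :: "outcome measure" +
  assumes inv: "order_invariant \<mu>"
begin

lemma space_eq [simp]: "space \<mu> = Omega" and sets_eq [simp]: "sets \<mu> = event_field"
  using inv unfolding order_invariant_def by blast+

text \<open>
  Order-invariance, which is an equation between basic events, says that a linear extension \<open>l\<close> of \<open>r\<close> carries \<open>\<mu>\<close>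
  restricted to the fibre of \<open>r\<close> to \<open>\<mu>\<close> restricted to the fibre of \<open>perm_order l r\<close>. The basic events
  are closed under intersection and generate the events, so it is enough to check this on them; there it holds because
  the trace of a basic event on the fibre is a basic event of level at least \<open>k\<close>, to which
  order-invariance applies with the prolongation of \<open>l\<close>.
\<close>

lemma transport:
  assumes r: "suborder {1..k} r" and l: "l \<in> lin_exts k r" and E: "E \<in> event_field"
  shows transport_event: "{\<omega> \<in> fibre k r. perm_outcome l \<omega> \<in> E} \<in> event_field"
    and transport_prob: "prob {\<omega> \<in> fibre k r. perm_outcome l \<omega> \<in> E} = prob (E \<inter> fibre k (perm_order l r))"
proof -
  let ?T = "\<lambda>E. {\<omega> \<in> fibre k r. perm_outcome l \<omega> \<in> E}"
  let ?s = "perm_order l r"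
  let ?P = "\<lambda>E. ?T E \<in> event_field \<and> prob (?T E) = prob (E \<inter> fibre k ?s)"
  have p: "l permutes {1..k}" using l by (rule lin_exts_permutes)
  have s: "suborder {1..k} ?s" by (rule suborder_perm_order[OF r _ _ l]) auto
  have fib: "fibre k r \<in> event_field" "fibre k ?s \<in> event_field"
    using r s by (auto intro: fibre_mem_event_field)
  have T_fibre: "?T (E \<inter> fibre k ?s) = ?T E" for E
    using perm_outcome_in_fibre[OF _ l] by auto
  have on_basic: "?P E" if EB: "E \<in> basic_events" for E
  proof -
    obtain k' B r' where B: "1 \<le> k'" "borel_family k' B" "suborder {1..k'} r'"
      and E: "E = basic_event k' B r'"
      using EB unfolding basic_events_def by blast
    show ?thesis
    proof (cases rule: basic_event_Int_fibre[OF B s])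
      case 1
      then have "E \<inter> fibre k ?s = {}" unfolding E .
      moreover from this have "?T E = {}" using T_fibre[of E] by simp
      ultimately show ?thesis by (simp only: event_field.empty_sets measure_empty simp_thms)
    next
      case (2 K C t)
      have pK: "l permutes {1..K}" using p 2(1) by (auto intro: permutes_subset)
      \<comment> \<open>The preimage of the trace is again a basic event, with factors and order permuted by inv l;
          order-invariance applied to it and l gives back the trace.\<close>
      define C' where "C' i = C (inv l i)" for i
      define t' where "t' = perm_order (inv l) t"
      have T: "?T E = basic_event K C' t'"
        using T_fibre[of E] perm_outcome_vimage_basic_event[OF r l 2(1) 2(5)]
        unfolding E 2(6) C'_def t'_def by simp
      have inK: "inv l i \<in> {1..K} \<longleftrightarrow> i \<in> {1..K}" for i
        by (rule permutes_in_image[OF permutes_inv[OF pK]])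
      have C': "borel_family K C'"
        using 2(3) inK unfolding borel_family_def C'_def by blast
      have mt: "inv l \<in> lin_exts k t"
      proof -
        have "inv l \<in> lin_exts k ?s" using r l by (rule inv_mem_lin_exts)
        then show ?thesis using 2(5) lin_exts_restr[of k t] by simp
      qed
      have t': "suborder {1..K} t'"
        unfolding t'_def by (rule suborder_perm_order[OF 2(4) _ _ mt]) (use 2(1) in auto)
      have lt: "perm_order l t' = t" "(\<lambda>i. C' (l i)) = C"
        using permutes_inv_o[OF p] permutes_inverses[OF p]
        by (simp_all add: t'_def C'_def perm_order_comp)
      have "linear_extension K t' l"
        unfolding linear_extension_def
      proof (intro conjI ballI impI)
        show "l permutes {1..K}" by (rule pK)
        fix i j assume "(l i, l j) \<in> t'"
        then have "(i, j) \<in> t" using lt(1) by (metis mem_perm_order)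
        then show "i < j" using 2(4) by (auto simp: suborder_def)
      qed
      then have "prob (basic_event K C' t') = prob (basic_event K C t)"
        using inv 2(2) C' t' lt unfolding order_invariant_def by metis
      moreover have "basic_event K C' t' \<in> event_field"
        using basic_eventI[OF 2(2) C' t'] by (simp add: event_field_def sigma_sets.Basic)
      ultimately show ?thesis unfolding T using 2(6) E by simp
    qed
  qed
  have "?P E"
    using Int_stable_basic_events basic_events_subset E[unfolded event_field_def]
  proof (induction rule: sigma_sets_induct_disjoint)
    case (basic E)
    then show ?case by (rule on_basic)
  next
    case empty
    then show ?case by simp
  next
    case (compl E)
    then have E: "E \<in> event_field" by (simp add: event_field_def)
    have "?T (Omega - E) = fibre k r - ?T E"
      using perm_outcome_in_fibre[OF _ l] by (auto simp: fibre_def)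
    moreover have "(Omega - E) \<inter> fibre k ?s = fibre k ?s - (E \<inter> fibre k ?s)"
      by (auto simp: fibre_def)
    moreover have "prob (fibre k r) = prob (fibre k ?s)"
    proof -
      have "?T Omega = fibre k r" using perm_outcome_in_fibre[OF _ l] by (auto simp: fibre_def)
      moreover have "Omega \<inter> fibre k ?s = fibre k ?s" by (auto simp: fibre_def)
      ultimately show ?thesis using on_basic[OF Omega_mem_basic_events] by simp
    qed
    moreover have "?T E \<in> event_field" "prob (?T E) = prob (E \<inter> fibre k ?s)"
      using compl(2) by auto
    moreover have "prob (fibre k r - ?T E) = prob (fibre k r) - prob (?T E)"
      using fib calculation(4) by (intro finite_measure_Diff) auto
    moreover have "prob (fibre k ?s - (E \<inter> fibre k ?s)) = prob (fibre k ?s) - prob (E \<inter> fibre k ?s)"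
      using fib E by (intro finite_measure_Diff) auto
    ultimately show ?case
      using fib by (simp only:) (blast intro: event_field.Diff)
  next
    case (union A)
    then have A: "range A \<subseteq> event_field" by (simp add: event_field_def)
    have T: "?T (\<Union>i. A i) = (\<Union>i. ?T (A i))" by auto
    have TA: "range (\<lambda>i. ?T (A i)) \<subseteq> event_field" using union by auto
    have AF: "range (\<lambda>i. A i \<inter> fibre k ?s) \<subseteq> event_field" using A fib by auto
    have "(\<lambda>i. prob (?T (A i))) sums prob (\<Union>i. ?T (A i))"
      using TA union(1) by (intro finite_measure_UNION) (auto simp: disjoint_family_on_def)
    moreover have "(\<lambda>i. prob (A i \<inter> fibre k ?s)) sums prob (\<Union>i. A i \<inter> fibre k ?s)"
      using AF union(1) by (intro finite_measure_UNION) (auto simp: disjoint_family_on_def)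
    ultimately have "prob (\<Union>i. ?T (A i)) = prob (\<Union>i. A i \<inter> fibre k ?s)"
      using union(3) by (simp add: sums_unique2)
    then show ?case using TA unfolding T by auto
  qed
  then show "?T E \<in> event_field" "prob (?T E) = prob (E \<inter> fibre k ?s)" by auto
qed


lemma finite_suborders: "finite {r. suborder {1..k} r}"
  by (rule finite_subset[of _ "Pow ({1..k} \<times> {1..k})"]) (auto simp: suborder_def)

text \<open>
  On each of the finitely many fibres the averaging set is fixed, so \<open>nu\<close> is a finite combination of
  indicators of transported events.
\<close>

lemma nu_eq_sum_fibres:
  assumes w: "\<omega> \<in> Omega"
  shows "nu k E \<omega> = (\<Sum>r | suborder {1..k} r. \<Sum>l\<in>lin_exts k r.
      indicator {\<omega> \<in> fibre k r. perm_outcome l \<omega> \<in> E} \<omega> / card (lin_exts k r))"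
proof -
  let ?r = "restr k (snd \<omega>)"
  have "(\<Sum>l\<in>lin_exts k r. indicator {\<omega> \<in> fibre k r. perm_outcome l \<omega> \<in> E} \<omega> / card (lin_exts k r))
      = (if r = ?r then nu k E \<omega> else 0)" for r
  proof (cases "r = ?r")
    case True
    then have wr: "\<omega> \<in> fibre k r" using w by (simp add: fibre_def)
    then have "indicator {\<omega> \<in> fibre k r. perm_outcome l \<omega> \<in> E} \<omega> = (indicator E (perm_outcome l \<omega>) :: real)" for l
      by (simp add: indicator_def)
    then show ?thesis
      by (simp add: nu_eq_sum lin_exts_fibre[OF wr] True[symmetric] sum_divide_distrib)
  next
    case False
    then have "\<omega> \<notin> fibre k r" by (auto simp: fibre_def)
    then show ?thesis using False by simp
  qed
  moreover have "suborder {1..k} ?r" by (rule suborder_restr[OF Omega_suborder[OF w]])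
  ultimately show ?thesis using finite_suborders by simp
qed

lemma nu_measurable: "E \<in> event_field \<Longrightarrow> nu k E \<in> borel_measurable \<mu>"
proof -
  assume E: "E \<in> event_field"
  have "(\<lambda>\<omega>. \<Sum>r | suborder {1..k} r. \<Sum>l\<in>lin_exts k r.
      indicator {\<omega> \<in> fibre k r. perm_outcome l \<omega> \<in> E} \<omega> / real (card (lin_exts k r))) \<in> borel_measurable \<mu>"
    using E by (intro borel_measurable_sum borel_measurable_divide borel_measurable_indicator)
      (auto intro: transport_event)
  then show ?thesis
    by (subst measurable_cong[OF nu_eq_sum_fibres]) simp_all
qed

text \<open>
  Integrating fibre by fibre gives a sum over pairs \<open>(r, l)\<close> of the probability of \<open>E\<close> in the fibre of
  \<open>perm_order l r\<close>, divided by the number of linear extensions of \<open>r\<close>. The involution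
  \<open>(r, l) \<mapsto> (perm_order l r, inv l)\<close> preserves that number and turns the sum into one whose terms do
  not depend on \<open>l\<close>; it collapses to the sum of the probabilities of \<open>E\<close> in the fibres.
\<close>

lemma expectation_nu:
  assumes E: "E \<in> event_field"
  shows "expectation (nu k E) = prob E"
proof -
  let ?S = "{r. suborder {1..k} r}"
  let ?g = "\<lambda>r. prob (E \<inter> fibre k r)"
  let ?c = "\<lambda>r. real (card (lin_exts k r))"
  let ?\<phi> = "\<lambda>(r, l). (perm_order l r, inv l) :: (nat \<times> nat) set \<times> (nat \<Rightarrow> nat)"
  have T: "{\<omega> \<in> fibre k r. perm_outcome l \<omega> \<in> E} \<in> event_field"
    if "suborder {1..k} r" "l \<in> lin_exts k r" for r l
    using that E by (rule transport_event)
  have "expectation (nu k E) = expectation (\<lambda>\<omega>. \<Sum>r\<in>?S. \<Sum>l\<in>lin_exts k r.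
      indicator {\<omega> \<in> fibre k r. perm_outcome l \<omega> \<in> E} \<omega> / ?c r)"
    by (rule Bochner_Integration.integral_cong) (auto simp: nu_eq_sum_fibres)
  also have "\<dots> = (\<Sum>r\<in>?S. \<Sum>l\<in>lin_exts k r. prob {\<omega> \<in> fibre k r. perm_outcome l \<omega> \<in> E} / ?c r)"
    using T by (subst Bochner_Integration.integral_sum)
      (auto intro!: Bochner_Integration.integrable_sum sum.cong integrable_divide integrable_real_indicator
         simp: emeasure_finite less_top[symmetric])
  also have "\<dots> = (\<Sum>r\<in>?S. \<Sum>l\<in>lin_exts k r. ?g (perm_order l r) / ?c r)"
    using E by (auto intro!: sum.cong simp: transport_prob)
  also have "\<dots> = (\<Sum>(r, l)\<in>Sigma ?S (lin_exts k). ?g (perm_order l r) / ?c r)"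
    using finite_suborders finite_lin_exts by (subst sum.Sigma) auto
  also have "\<dots> = (\<Sum>(r, l)\<in>Sigma ?S (lin_exts k). ?g r / ?c r)"
  proof (rule sum.reindex_bij_witness[where i="?\<phi>" and j="?\<phi>"])
    fix a assume "a \<in> Sigma ?S (lin_exts k)"
    then obtain r l where a: "a = (r, l)" and r: "suborder {1..k} r" and l: "l \<in> lin_exts k r" by auto
    have p: "l permutes {1..k}" using l by (rule lin_exts_permutes)
    show "?\<phi> (?\<phi> a) = a"
      using permutes_inv_o[OF p] by (simp add: a perm_order_comp inv_inv_eq permutes_bij[OF p])
    then show "?\<phi> (?\<phi> a) = a" .
    have "suborder {1..k} (perm_order l r)" by (rule suborder_perm_order[OF r _ _ l]) auto
    then show "?\<phi> a \<in> Sigma ?S (lin_exts k)"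
      using inv_mem_lin_exts[OF r l] by (simp add: a)
    then show "?\<phi> a \<in> Sigma ?S (lin_exts k)" .
    show "(case ?\<phi> a of (r, l) \<Rightarrow> ?g r / ?c r) = (case a of (r, l) \<Rightarrow> ?g (perm_order l r) / ?c r)"
      by (simp add: a card_lin_exts_perm_order[OF r l])
  qed
  also have "\<dots> = (\<Sum>r\<in>?S. \<Sum>l\<in>lin_exts k r. ?g r / ?c r)"
    using finite_suborders finite_lin_exts by (subst sum.Sigma) auto
  also have "\<dots> = (\<Sum>r\<in>?S. ?g r)"
  proof (rule sum.cong)
    fix r assume "r \<in> ?S"
    then have "0 < card (lin_exts k r)" by (intro card_lin_exts_pos) simp
    then show "(\<Sum>l\<in>lin_exts k r. ?g r / ?c r) = ?g r" by simp
  qed simp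
  also have "\<dots> = prob (\<Union>r\<in>?S. E \<inter> fibre k r)"
    using E finite_suborders fibre_mem_event_field
    by (intro finite_measure_finite_Union[symmetric]) (auto simp: disjoint_family_on_def fibre_def)
  also have "(\<Union>r\<in>?S. E \<inter> fibre k r) = E"
    using event_field.sets_into_space[OF E] suborder_restr[OF Omega_suborder]
    by (auto simp: fibre_def)
  finally show ?thesis .
qed

text \<open>
  Only the measurable sets matter: this is the sub-\<open>\<sigma>\<close>-algebra \<open>G_upto k\<close> in the form in which measurability of
  functions can be expressed.
\<close>

definition sym_measure :: "nat \<Rightarrow> outcome measure" where
  "sym_measure k = sigma Omega (G_upto k)"

lemma space_sym_measure [simp]: "space (sym_measure k) = Omega"
  by (simp add: sym_measure_def space_measure_of_conv)

lemma sets_sym_measure [simp]: "sets (sym_measure k) = G_upto k"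
  unfolding sym_measure_def by (rule sigma_algebra.sets_measure_of_eq[OF sigma_algebra_G_upto])

lemma nu_measurable_sym:
  assumes E: "E \<in> event_field"
  shows "nu k E \<in> borel_measurable (sym_measure k)"
proof (rule measurableI)
  fix A :: "real set" assume A: "A \<in> sets borel"
  have "nu k E -` A \<inter> Omega \<in> event_field"
    using measurable_sets[OF nu_measurable[OF E] A] by simp
  then show "nu k E -` A \<inter> space (sym_measure k) \<in> sets (sym_measure k)"
    using perm_outcome_in_Omega nu_perm_outcome by (auto simp: mem_G_upto)
qed simp

text \<open>
  By \<open>nu_Int\<close> and \<open>expectation_nu\<close>, the integral of \<open>nu k E\<close> over \<open>H \<in> G_upto k\<close> is the probability of
  \<open>E \<inter> H\<close>. The fields \<open>G_upto k\<close> decrease, so \<open>nu k E\<close> is a bounded reverse martingale.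
\<close>

lemma nu_converges_AE:
  assumes E: "E \<in> event_field"
  shows "AE \<omega> in \<mu>. convergent (\<lambda>k. nu k E \<omega>)"
proof (rule reverse_martingale_converges[where F=sym_measure and C=1])
  show "subalgebra \<mu> (sym_measure k)" for k
    by (auto simp: subalgebra_def mem_G_upto)
  show "sets (sym_measure n) \<subseteq> sets (sym_measure m)" if "m \<le> n" for m n
    using G_upto_antimono[OF that] by simp
  show "nu k E \<in> borel_measurable (sym_measure k)" for k
    using E by (rule nu_measurable_sym)
  show "\<bar>nu k E \<omega>\<bar> \<le> 1" for k \<omega> by (rule abs_nu_le_1)
  have version: "(\<integral>\<omega>\<in>H. nu k E \<omega> \<partial>\<mu>) = prob (E \<inter> H)" if H: "H \<in> G_upto k" for k H
  proof -
    have "(\<integral>\<omega>\<in>H. nu k E \<omega> \<partial>\<mu>) = expectation (nu k (E \<inter> H))"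
      unfolding set_lebesgue_integral_def
      by (rule Bochner_Integration.integral_cong) (simp_all add: nu_Int[OF H])
    also have "\<dots> = prob (E \<inter> H)"
      using E H by (intro expectation_nu) (auto simp: mem_G_upto)
    finally show ?thesis .
  qed
  show "(\<integral>\<omega>\<in>H. nu m E \<omega> \<partial>\<mu>) = (\<integral>\<omega>\<in>H. nu n E \<omega> \<partial>\<mu>)"
    if "m \<le> n" "H \<in> sets (sym_measure n)" for m n H
    using that G_upto_antimono[OF that(1)] by (auto simp: version)
qed

section \<open>Extremal measures, trivial tails and essential measures\<close>

text \<open>
  An adjacent swap at \<open>i\<close> leaves \<open>nu k E\<close> unchanged as soon as \<open>k > i\<close>, hence it does not affect the limit.
\<close>

lemma lim_nu_adj_swap:
  assumes w: "\<omega> \<in> Omega" and i: "1 \<le> i"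
  shows "lim (\<lambda>k. nu k E (adj_swap i \<omega>)) = lim (\<lambda>k. nu k E \<omega>)"
proof -
  have "nu k E (adj_swap i \<omega>) = nu k E \<omega>" if "i < k" for k
    using adj_swap_eq_perm_outcome[OF w i that] nu_perm_outcome[OF w] by metis
  then have "\<forall>\<^sub>F k in sequentially. nu k E (adj_swap i \<omega>) = nu k E \<omega>"
    by (auto intro: eventually_mono[OF eventually_gt_at_top[of i]])
  then have "((\<lambda>k. nu k E (adj_swap i \<omega>)) \<longlonglongrightarrow> L) \<longleftrightarrow> ((\<lambda>k. nu k E \<omega>) \<longlonglongrightarrow> L)" for L
    by (rule tendsto_cong)
  then show ?thesis by (simp add: lim_def)
qed

lemma adj_swap_in_Omega: "\<omega> \<in> Omega \<Longrightarrow> 1 \<le> i \<Longrightarrow> adj_swap i \<omega> \<in> Omega"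
  using adj_swap_eq_perm_outcome[of \<omega> i "Suc i"] perm_outcome_in_Omega[of \<omega>] by fastforce

lemma lim_nu_measurable: "E \<in> event_field \<Longrightarrow> (\<lambda>\<omega>. lim (\<lambda>k. nu k E \<omega>)) \<in> borel_measurable \<mu>"
  by (intro borel_measurable_lim_metric nu_measurable)

lemma lim_nu_level_set_tail:
  assumes E: "E \<in> event_field" and A: "A \<in> sets borel"
  shows "{\<omega> \<in> Omega. lim (\<lambda>k. nu k E \<omega>) \<in> A} \<in> tail_field"
proof -
  have "(\<lambda>\<omega>. lim (\<lambda>k. nu k E \<omega>)) -` A \<inter> space \<mu> \<in> sets \<mu>"
    using lim_nu_measurable[OF E] A by (rule measurable_sets)
  then have "{\<omega> \<in> Omega. lim (\<lambda>k. nu k E \<omega>) \<in> A} \<in> event_field"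
    by (simp add: vimage_def Int_def conj_commute)
  then show ?thesis
    by (auto simp: tail_field_def G_upto_def lim_nu_adj_swap adj_swap_in_Omega)
qed

text \<open>
  The almost sure limit of \<open>nu k E\<close> is a tail function, so each of the events that it exceeds, or
  falls below, the probability of \<open>E\<close> has probability 0 or 1. Its expectation is that probability by dominated
  convergence, which excludes 1 in both cases.
\<close>

lemma trivial_tails_imp_essential:
  assumes triv: "trivial_tails \<mu>"
  shows "essential \<mu>"
  unfolding essential_def
proof
  fix E assume E: "E \<in> event_field"
  let ?X = "\<lambda>\<omega>. lim (\<lambda>k. nu k E \<omega>)"
  note X = lim_nu_measurable[OF E]
  have conv: "AE \<omega> in \<mu>. (\<lambda>k. nu k E \<omega>) \<longlonglongrightarrow> ?X \<omega>"
    using nu_converges_AE[OF E] by (simp add: convergent_LIMSEQ_iff)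
  have nb: "AE \<omega> in \<mu>. norm (nu k E \<omega>) \<le> 1" for k
    by (simp add: abs_nu_le_1)
  have intX: "integrable \<mu> ?X"
    by (rule integrable_dominated_convergence[OF X nu_measurable[OF E] _ conv nb]) simp
  have "(\<lambda>k. expectation (nu k E)) \<longlonglongrightarrow> expectation ?X"
    by (rule integral_dominated_convergence[OF X nu_measurable[OF E] _ conv nb]) simp
  then have eX: "expectation ?X = prob E"
    using E by (simp add: expectation_nu LIMSEQ_const_iff)
  have sets: "{\<omega> \<in> Omega. ?X \<omega> \<in> A} \<in> event_field" if "A \<in> sets borel" for A
    using lim_nu_level_set_tail[OF E that] by (auto simp: tail_field_def G_upto_def)
  have zero_one: "(AE \<omega> in \<mu>. ?X \<omega> \<in> A) \<or> (AE \<omega> in \<mu>. ?X \<omega> \<notin> A)" if A: "A \<in> sets borel" for A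
  proof -
    have "prob {\<omega> \<in> Omega. ?X \<omega> \<in> A} \<in> {0, 1}"
      using triv lim_nu_level_set_tail[OF E A] by (auto simp: trivial_tails_def)
    then consider "AE \<omega> in \<mu>. \<omega> \<notin> {\<omega> \<in> Omega. ?X \<omega> \<in> A}" | "AE \<omega> in \<mu>. \<omega> \<in> {\<omega> \<in> Omega. ?X \<omega> \<in> A}"
      using prob_eq_0[OF sets[OF A, folded sets_eq]] prob_eq_1[OF sets[OF A, folded sets_eq]]
      by blast
    then show ?thesis
    proof cases
      case 1
      with AE_space[of \<mu>] have "AE \<omega> in \<mu>. ?X \<omega> \<notin> A" by eventually_elim simp
      then show ?thesis ..
    next
      case 2
      then have "AE \<omega> in \<mu>. ?X \<omega> \<in> A" by eventually_elim simp
      then show ?thesis ..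
    qed
  qed
  have "AE \<omega> in \<mu>. ?X \<omega> \<notin> {prob E<..}"
  proof (rule ccontr)
    assume "\<not> ?thesis"
    then have "AE \<omega> in \<mu>. prob E < ?X \<omega>" using zero_one[of "{prob E<..}"] by auto
    then show False using expectation_greater[OF intX] eX by auto
  qed
  moreover have "AE \<omega> in \<mu>. ?X \<omega> \<notin> {..<prob E}"
  proof (rule ccontr)
    assume "\<not> ?thesis"
    then have "AE \<omega> in \<mu>. ?X \<omega> < prob E" using zero_one[of "{..<prob E}"] by auto
    then show False using expectation_less[OF intX] eX by auto
  qed
  ultimately show "AE \<omega> in \<mu>. (\<lambda>k. nu k E \<omega>) \<longlonglongrightarrow> prob E"
    using conv
  proof eventually_elim
    case (elim \<omega>)
    then have "?X \<omega> = prob E" by simp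
    then show ?case using elim(3) by metis
  qed
qed

text \<open>
  The averages \<open>nu k E\<close> do not depend on the measure. Their almost sure limit under \<open>\<mu>\<close> is thus also the
  limit under \<open>M\<close>, which is absolutely continuous with respect to \<open>\<mu>\<close>, and integrating them against \<open>M\<close>
  recovers \<open>M\<close>.
\<close>

lemma essential_dominates_eq:
  assumes ess: "essential \<mu>" and M: "order_invariant M" and c: "0 < c"
    and dom: "\<And>E. E \<in> event_field \<Longrightarrow> c * measure M E \<le> prob E"
  shows "M = \<mu>"
proof -
  have "prob_space M" using M unfolding order_invariant_def by blast
  then interpret M: order_invariant_measure M
    using M by (intro order_invariant_measure.intro order_invariant_measure_axioms.intro)
  have null: "null_sets \<mu> \<subseteq> null_sets M"
  proof
    fix N assume "N \<in> null_sets \<mu>"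
    then have N: "N \<in> event_field" "prob N = 0" by (auto simp: null_sets_def measure_def)
    have "c * measure M N \<le> 0" using dom[OF N(1)] unfolding N(2) .
    then have "measure M N \<le> 0" using c by (simp only: mult_le_0_iff not_less[symmetric]) auto
    then have "measure M N = 0" by (rule antisym) (rule measure_nonneg)
    then show "N \<in> null_sets M" using N(1) by (simp add: null_sets_def M.emeasure_eq_measure)
  qed
  have eq: "measure M E = prob E" if E: "E \<in> event_field" for E
  proof -
    have "AE \<omega> in \<mu>. (\<lambda>k. nu k E \<omega>) \<longlonglongrightarrow> prob E"
      using ess E by (simp add: essential_def)
    then have conv: "AE \<omega> in M. (\<lambda>k. nu k E \<omega>) \<longlonglongrightarrow> prob E"
      using null unfolding eventually_ae_filter by auto
    have nb: "AE \<omega> in M. norm (nu k E \<omega>) \<le> 1" for k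
      by (simp add: abs_nu_le_1)
    have "(\<lambda>k. M.expectation (nu k E)) \<longlonglongrightarrow> M.expectation (\<lambda>_. prob E)"
      by (rule integral_dominated_convergence[OF _ M.nu_measurable[OF E] _ conv nb]) simp_all
    moreover have "M.expectation (\<lambda>_. prob E) = prob E" using M.prob_space by simp
    ultimately show ?thesis
      unfolding M.expectation_nu[OF E] by (simp only: LIMSEQ_const_iff)
  qed
  show ?thesis
    by (rule measure_eqI) (simp_all add: M.emeasure_eq_measure emeasure_eq_measure eq)
qed

lemma essential_imp_extremal:
  assumes ess: "essential \<mu>"
  shows "extremal \<mu>"
  unfolding extremal_def
proof clarify
  fix r M N
  assume r: "0 < r" "r < 1" and MN: "order_invariant M" "order_invariant N" "M \<noteq> N"
    and mix: "\<forall>E\<in>event_field. prob E = r * measure M E + (1 - r) * measure N E"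
  have "M = \<mu>"
    using r mix by (intro essential_dominates_eq[OF ess MN(1) r(1)]) simp
  moreover have "N = \<mu>"
    using r mix by (intro essential_dominates_eq[OF ess MN(2), of "1 - r"]) simp_all
  ultimately show False using MN(3) by simp
qed

text \<open>
  Conditioning on a tail event \<open>H\<close> preserves order-invariance: a linear extension carries the basic event onto
  its permuted version and does not change membership in \<open>H\<close>, so the parts of both inside \<open>H\<close>
  are also carried onto each other.
\<close>

lemma order_invariant_uniform_measure:
  assumes H: "H \<in> tail_field" "0 < prob H"
  shows "order_invariant (uniform_measure \<mu> H)"
  unfolding order_invariant_def
proof (intro conjI allI impI)
  have Hk: "H \<in> G_upto k" if "1 \<le> k" for k using H(1) that by (auto simp: tail_field_def)
  have HE: "H \<in> event_field" using Hk[of 1] by (simp add: mem_G_upto)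
  have e: "emeasure \<mu> H \<noteq> 0" "emeasure \<mu> H \<noteq> \<infinity>" using H(2) by (simp_all add: emeasure_eq_measure)
  show "prob_space (uniform_measure \<mu> H)" using e by (rule prob_space_uniform_measure)
  show "space (uniform_measure \<mu> H) = Omega" "sets (uniform_measure \<mu> H) = event_field" by simp_all
  fix k B r l
  assume *: "1 \<le> k \<and> borel_family k B \<and> suborder {1..k} r \<and> linear_extension k r l"
  then have k: "1 \<le> k" and B: "borel_family k B" and r: "suborder {1..k} r" by auto
  have "restr k r = r" using r by (auto simp: suborder_def)
  then have l: "l \<in> lin_exts k r" using * by (simp add: lin_exts_def)
  have p: "l permutes {1..k}" using l by (rule lin_exts_permutes)
  let ?s = "perm_order l r"
  let ?E = "basic_event k (\<lambda>i. B (l i)) ?s"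
  have s: "suborder {1..k} ?s" by (rule suborder_perm_order[OF r _ _ l]) auto
  have "restr k ?s = ?s" using s by (auto simp: suborder_def)
  have "borel_family k (\<lambda>i. B (l i))"
    using B permutes_in_image[OF p] unfolding borel_family_def by blast
  then have E: "?E \<in> event_field" "basic_event k B r \<in> event_field"
    using basic_eventI[OF k] B r s by (simp_all add: event_field_def sigma_sets.Basic)
  have "perm_order (inv l) ?s = r" "(\<lambda>i. B (l (inv l i))) = B"
    using permutes_inv_o[OF p] permutes_inverses[OF p] by (simp_all add: perm_order_comp)
  then have T: "{\<omega> \<in> fibre k r. perm_outcome l \<omega> \<in> ?E} = basic_event k B r"
    using perm_outcome_vimage_basic_event[OF r l order_refl \<open>restr k ?s = ?s\<close>, of "\<lambda>i. B (l i)"]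
    by simp
  have "prob (H \<inter> basic_event k B r) = prob {\<omega> \<in> fibre k r. perm_outcome l \<omega> \<in> H \<inter> ?E}"
  proof -
    have "perm_outcome l \<omega> \<in> H \<longleftrightarrow> \<omega> \<in> H" if "\<omega> \<in> fibre k r" for \<omega>
      using that l by (intro perm_outcome_mem_G_upto_iff[OF Hk[OF k]])
        (simp_all add: lin_exts_fibre, simp add: fibre_def)
    then have "H \<inter> basic_event k B r = {\<omega> \<in> fibre k r. perm_outcome l \<omega> \<in> H \<inter> ?E}"
      unfolding T[symmetric] by blast
    then show ?thesis by simp
  qed
  also have "\<dots> = prob (H \<inter> ?E \<inter> fibre k ?s)"
    using r l E HE by (intro transport_prob) auto
  also have "?E \<subseteq> fibre k ?s" by (intro subsetI) (simp add: mem_basic_event fibre_def)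
  then have "H \<inter> ?E \<inter> fibre k ?s = H \<inter> ?E" by blast
  finally show "measure (uniform_measure \<mu> H) (basic_event k B r) = measure (uniform_measure \<mu> H) ?E"
    using E e by simp
qed

text \<open>
  If a tail event has probability strictly between 0 and 1, conditioning on it and on its complement
  splits \<open>\<mu>\<close> into two order-invariant measures, which differ on the event.
\<close>

lemma extremal_imp_trivial_tails:
  assumes ext: "extremal \<mu>"
  shows "trivial_tails \<mu>"
  unfolding trivial_tails_def
proof (rule ballI, rule ccontr)
  fix H assume H: "H \<in> tail_field" and "prob H \<notin> {0, 1}"
  then have pos: "0 < prob H" "prob H < 1"
    using prob_le_1[of H] measure_nonneg[of \<mu> H] by (auto simp: less_le)
  have HE: "H \<in> event_field" using H by (auto simp: tail_field_def G_upto_def)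
  have "Omega - H \<in> tail_field"
    using H algebra.compl_sets[OF sigma_algebra.axioms(1)[OF sigma_algebra_G_upto]]
    by (auto simp: tail_field_def)
  have compl: "prob (Omega - H) = 1 - prob H" using prob_compl[of H] HE by simp
  let ?M = "uniform_measure \<mu> H" and ?N = "uniform_measure \<mu> (Omega - H)"
  have M: "measure ?M E = prob (H \<inter> E) / prob H" if "E \<in> event_field" for E
    using that pos by (simp add: emeasure_eq_measure)
  have N: "measure ?N E = prob ((Omega - H) \<inter> E) / (1 - prob H)" if "E \<in> event_field" for E
    using that pos compl by (simp add: emeasure_eq_measure)
  have mix: "prob E = prob H * measure ?M E + (1 - prob H) * measure ?N E" if E: "E \<in> event_field" for E
  proof -
    have "E = (H \<inter> E) \<union> ((Omega - H) \<inter> E)" using event_field.sets_into_space[OF E] by auto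
    then have "prob E = prob (H \<inter> E) + prob ((Omega - H) \<inter> E)"
      using finite_measure_Union[of "H \<inter> E" "(Omega - H) \<inter> E"] E HE by auto
    then show ?thesis using pos E by (simp add: M N)
  qed
  have "measure ?M H = 1" using M[OF HE] pos by simp
  moreover have "measure ?N H = 0" using N[OF HE] by (simp add: Int_commute Diff_disjoint)
  ultimately have "?M \<noteq> ?N" by auto
  moreover have "order_invariant ?M" using H pos(1) by (rule order_invariant_uniform_measure)
  moreover have "order_invariant ?N"
    using \<open>Omega - H \<in> tail_field\<close> pos(2) compl by (intro order_invariant_uniform_measure) auto
  ultimately show False using ext pos mix unfolding extremal_def by blast
qed

end

theorem theorem7p2:
  fixes \<mu> :: "outcome measure"
  assumes "order_invariant \<mu>"
  shows "(extremal \<mu> \<longleftrightarrow> trivial_tails \<mu>) \<and> (trivial_tails \<mu> \<longleftrightarrow> essential \<mu>)"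
proof -
  have "prob_space \<mu>" using assms unfolding order_invariant_def by blast
  then interpret order_invariant_measure \<mu>
    using assms by (intro order_invariant_measure.intro order_invariant_measure_axioms.intro)
  show ?thesis
    using extremal_imp_trivial_tails trivial_tails_imp_essential essential_imp_extremal by blast
qed

end
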